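(* Vertex-deletion Preserving Strong Connectivity is $\mathsf{W[1]}$-hard.
   Context: Vertex-deletion Preserving Strong Connectivity, parameterized by $k$: given a strongly connected digraph $D$ and an integer $k$, is there a vertex set $S$ of size exactly $k$ such that $D-S$ is strongly connected? *)

theory Defs
  imports "Graph_Theory.Graph_Theory"
begin

section \<open>Model of computation\<close>

text \<open>
  Instances are finite binary trees, which play the role of words over a finite alphabet
  (a tree with n nodes is a well-bracketed word of length O(n)).  Algorithms are programs of
  a WHILE language over trees.  Time is charged so that the model is polynomially equivalent to
  Turing machines: an assignment costs at least the size of the tree it stores (no sharing of
  subtrees), so a computation of time t on an input of size n never stores a tree of size more
  than max n t.  An expression evaluates a number of operations fixed by the program, and
  its intermediate values exceed the stored trees by at most a factor fixed by the program.
\<close>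

datatype dat = Nil_dat | Pair_dat dat dat

fun dat_size :: "dat \<Rightarrow> nat" where
  "dat_size Nil_dat = 1"
| "dat_size (Pair_dat a b) = 1 + dat_size a + dat_size b"

fun dat_hd :: "dat \<Rightarrow> dat" where
  "dat_hd Nil_dat = Nil_dat"
| "dat_hd (Pair_dat a b) = a"

fun dat_tl :: "dat \<Rightarrow> dat" where
  "dat_tl Nil_dat = Nil_dat"
| "dat_tl (Pair_dat a b) = b"

type_synonym store = "nat \<Rightarrow> dat"

datatype expr = Var nat | NilE | ConsE expr expr | HdE expr | TlE expr

fun expr_val :: "expr \<Rightarrow> store \<Rightarrow> dat" where
  "expr_val (Var v) s = s v"
| "expr_val NilE s = Nil_dat"
| "expr_val (ConsE a b) s = Pair_dat (expr_val a s) (expr_val b s)"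
| "expr_val (HdE a) s = dat_hd (expr_val a s)"
| "expr_val (TlE a) s = dat_tl (expr_val a s)"

datatype com =
    Skip
  | Assign nat expr
  | Seq com com
  | If expr com com
  | While expr com

text \<open>\<open>exec c s t s'\<close>: started in store \<open>s\<close>, the program \<open>c\<close> halts after time \<open>t\<close> in store \<open>s'\<close>.\<close>

inductive exec :: "com \<Rightarrow> store \<Rightarrow> nat \<Rightarrow> store \<Rightarrow> bool" where
  Skip: "exec Skip s 1 s"
| Assign: "exec (Assign v e) s (1 + dat_size (expr_val e s)) (s(v := expr_val e s))"
| Seq: "exec c1 s t1 s' \<Longrightarrow> exec c2 s' t2 s'' \<Longrightarrow> exec (Seq c1 c2) s (t1 + t2) s''"
| IfTrue: "expr_val e s \<noteq> Nil_dat \<Longrightarrow> exec c1 s t s' \<Longrightarrow> exec (If e c1 c2) s (1 + t) s'"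
| IfFalse: "expr_val e s = Nil_dat \<Longrightarrow> exec c2 s t s' \<Longrightarrow> exec (If e c1 c2) s (1 + t) s'"
| WhileFalse: "expr_val e s = Nil_dat \<Longrightarrow> exec (While e c) s 1 s"
| WhileTrue: "expr_val e s \<noteq> Nil_dat \<Longrightarrow> exec c s t1 s' \<Longrightarrow> exec (While e c) s' t2 s''
    \<Longrightarrow> exec (While e c) s (1 + t1 + t2) s''"

lemma exec_deterministic:
  "exec c s t s' \<Longrightarrow> exec c s u s'' \<Longrightarrow> t = u \<and> s' = s''"
proof (induction arbitrary: u s'' rule: exec.induct)
  case (Skip s) from Skip.prems show ?case by cases auto
next
  case (Assign v e s) from Assign.prems show ?case by cases auto
next
  case (Seq c1 s t1 s' c2 t2 r)
  from Seq.prems show ?case by cases (use Seq.IH in blast)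
next
  case (IfTrue e s c1 t s' c2)
  from IfTrue.prems show ?case by cases (use IfTrue.hyps IfTrue.IH in blast)+
next
  case (IfFalse e s c2 t s' c1)
  from IfFalse.prems show ?case by cases (use IfFalse.hyps IfFalse.IH in blast)+
next
  case (WhileFalse e s c)
  from WhileFalse.prems show ?case by cases (use WhileFalse.hyps in auto)
next
  case (WhileTrue e s c t1 s' t2 r)
  from WhileTrue.prems show ?case by cases (use WhileTrue.hyps WhileTrue.IH in blast)+
qed

text \<open>Input and output are passed in variable 0; all other variables start empty.\<close>

definition computes_in :: "com \<Rightarrow> dat \<Rightarrow> nat \<Rightarrow> dat \<Rightarrow> bool" where
  "computes_in p x t y \<longleftrightarrow> (\<exists>s. exec p ((\<lambda>_. Nil_dat)(0 := x)) t s \<and> s 0 = y)"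

fun enc_list :: "dat list \<Rightarrow> dat" where
  "enc_list [] = Nil_dat"
| "enc_list (x # xs) = Pair_dat x (enc_list xs)"

text \<open>Numbers are encoded in unary.\<close>

definition enc_nat :: "nat \<Rightarrow> dat" where
  "enc_nat n = enc_list (replicate n Nil_dat)"

lemma inj_enc_list: "enc_list xs = enc_list ys \<longleftrightarrow> xs = ys"
proof (induction xs arbitrary: ys)
  case Nil then show ?case by (cases ys) auto
next
  case (Cons x xs) then show ?case by (cases ys) auto
qed

lemma inj_enc_nat: "enc_nat m = enc_nat n \<longleftrightarrow> m = n"
  by (metis enc_nat_def inj_enc_list length_replicate)

definition computable :: "(nat \<Rightarrow> nat) \<Rightarrow> bool" where
  "computable f \<longleftrightarrow> (\<exists>p. \<forall>n. \<exists>t. computes_in p (enc_nat n) t (enc_nat (f n)))"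


section \<open>Parameterized problems and reductions\<close>

type_synonym param_problem = "(dat \<times> nat) set"

definition fpt_reducible :: "param_problem \<Rightarrow> param_problem \<Rightarrow> bool" (infix \<open>\<le>\<^sub>f\<^sub>p\<^sub>t\<close> 50) where
  "A \<le>\<^sub>f\<^sub>p\<^sub>t B \<longleftrightarrow>
    (\<exists>p f g c. computable f \<and> computable g \<and>
      (\<forall>x k. \<exists>x' k' t.
        computes_in p (Pair_dat x (enc_nat k)) t (Pair_dat x' (enc_nat k')) \<and>
        t \<le> f k * dat_size x ^ c \<and>
        k' \<le> g k \<and>
        ((x, k) \<in> A \<longleftrightarrow> (x', k') \<in> B)))"


section \<open>Boolean circuits, weighted circuit satisfiability, and the W-hierarchy\<close>

text \<open>
  A circuit is a directed acyclic graph whose nodes are listed in a topological order; a gate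
  refers to its in-neighbours by their positions in the list, and the last gate is the output.
\<close>

datatype gate = Input_gate | Not_gate nat | And_gate "nat list" | Or_gate "nat list"

type_synonym circuit = "gate list"

fun preds :: "gate \<Rightarrow> nat list" where
  "preds Input_gate = []"
| "preds (Not_gate j) = [j]"
| "preds (And_gate js) = js"
| "preds (Or_gate js) = js"

fun proper_gate :: "gate \<Rightarrow> bool" where
  "proper_gate Input_gate = True"
| "proper_gate (Not_gate j) = True"
| "proper_gate (And_gate js) = (distinct js \<and> length js \<ge> 2)"
| "proper_gate (Or_gate js) = (distinct js \<and> length js \<ge> 2)"

definition wf_circuit :: "circuit \<Rightarrow> bool" where
  "wf_circuit C \<longleftrightarrow> C \<noteq> [] \<and>
    (\<forall>i < length C. proper_gate (C ! i) \<and> (\<forall>j \<in> set (preds (C ! i)). j < i))"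

definition inputs :: "circuit \<Rightarrow> nat set" where
  "inputs C = {i. i < length C \<and> C ! i = Input_gate}"

text \<open>
  \<open>gate_val T vs g\<close> is the value of gate \<open>g\<close> when \<open>vs\<close> are the values of all preceding
  gates (so \<open>g\<close> has position \<open>length vs\<close>) and \<open>T\<close> is the set of input gates set to true.
\<close>

fun gate_val :: "nat set \<Rightarrow> bool list \<Rightarrow> gate \<Rightarrow> bool" where
  "gate_val T vs Input_gate \<longleftrightarrow> length vs \<in> T"
| "gate_val T vs (Not_gate j) \<longleftrightarrow> \<not> vs ! j"
| "gate_val T vs (And_gate js) \<longleftrightarrow> (\<forall>j \<in> set js. vs ! j)"
| "gate_val T vs (Or_gate js) \<longleftrightarrow> (\<exists>j \<in> set js. vs ! j)"

definition satisfies :: "nat set \<Rightarrow> circuit \<Rightarrow> bool" where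
  "satisfies T C \<longleftrightarrow> last (foldl (\<lambda>vs g. vs @ [gate_val T vs g]) [] C)"

definition circuit_path :: "circuit \<Rightarrow> nat list \<Rightarrow> bool" where
  "circuit_path C p \<longleftrightarrow> p \<noteq> [] \<and> set p \<subseteq> {..<length C} \<and>
    hd p \<in> inputs C \<and> last p = length C - 1 \<and>
    successively (\<lambda>i j. i \<in> set (preds (C ! j))) p"

definition depth_at_most :: "nat \<Rightarrow> circuit \<Rightarrow> bool" where
  "depth_at_most d C \<longleftrightarrow> (\<forall>p. circuit_path C p \<longrightarrow> length p - 1 \<le> d)"

definition weft_at_most :: "nat \<Rightarrow> circuit \<Rightarrow> bool" where
  "weft_at_most t C \<longleftrightarrow>
    (\<forall>p. circuit_path C p \<longrightarrow> length (filter (\<lambda>i. length (preds (C ! i)) > 2) p) \<le> t)"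

fun enc_gate :: "gate \<Rightarrow> dat" where
  "enc_gate Input_gate = Pair_dat (enc_nat 0) Nil_dat"
| "enc_gate (Not_gate j) = Pair_dat (enc_nat 1) (enc_nat j)"
| "enc_gate (And_gate js) = Pair_dat (enc_nat 2) (enc_list (map enc_nat js))"
| "enc_gate (Or_gate js) = Pair_dat (enc_nat 3) (enc_list (map enc_nat js))"

definition enc_circuit :: "circuit \<Rightarrow> dat" where
  "enc_circuit C = enc_list (map enc_gate C)"

lemma inj_enc_gate: "enc_gate g = enc_gate h \<longleftrightarrow> g = h"
  by (cases g; cases h)
    (auto simp: inj_enc_nat inj_enc_list simp del: One_nat_def
      dest!: map_injective intro: injI)

lemma inj_enc_circuit: "enc_circuit C = enc_circuit C' \<longleftrightarrow> C = C'"
  by (auto simp: enc_circuit_def inj_enc_list inj_enc_gate dest!: map_injective intro: injI)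

definition WCS :: "nat \<Rightarrow> nat \<Rightarrow> param_problem" where
  "WCS t d = {(enc_circuit C, k) | C k.
    wf_circuit C \<and> weft_at_most t C \<and> depth_at_most d C \<and>
    (\<exists>T \<subseteq> inputs C. card T = k \<and> satisfies T C)}"

definition W_class :: "nat \<Rightarrow> param_problem set" where
  "W_class t = {A. \<exists>d \<ge> 1. A \<le>\<^sub>f\<^sub>p\<^sub>t WCS t d}"

definition W_hard :: "nat \<Rightarrow> param_problem \<Rightarrow> bool" where
  "W_hard t B \<longleftrightarrow> (\<forall>A \<in> W_class t. A \<le>\<^sub>f\<^sub>p\<^sub>t B)"


section \<open>Vertex-deletion Preserving Strong Connectivity\<close>

text \<open>
  A digraph instance is given by its number of vertices and a list of its arcs.  The predicate
  \<open>digraph\<close> demands that arcs join distinct existing vertices; strongly connected digraphs have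
  at least one vertex.
\<close>

definition list_digraph :: "nat \<Rightarrow> (nat \<times> nat) list \<Rightarrow> (nat, nat \<times> nat) pre_digraph" where
  "list_digraph n es = \<lparr>verts = {0..<n}, arcs = set es, tail = fst, head = snd\<rparr>"

definition enc_digraph :: "nat \<Rightarrow> (nat \<times> nat) list \<Rightarrow> dat" where
  "enc_digraph n es =
    Pair_dat (enc_nat n) (enc_list (map (\<lambda>(u, v). Pair_dat (enc_nat u) (enc_nat v)) es))"

lemma inj_enc_digraph: "enc_digraph n es = enc_digraph m fs \<longleftrightarrow> n = m \<and> es = fs"
  by (auto simp: enc_digraph_def inj_enc_list inj_enc_nat dest!: map_injective intro!: injI)

definition preserves_strong_connectivity :: "('a, 'b) pre_digraph \<Rightarrow> 'a set \<Rightarrow> bool" where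
  "preserves_strong_connectivity D S \<longleftrightarrow> strongly_connected (D \<restriction> (verts D - S))"

definition VDPSC :: param_problem where
  "VDPSC = {(enc_digraph n es, k) | n es k.
    digraph (list_digraph n es) \<and> strongly_connected (list_digraph n es) \<and>
    (\<exists>S \<subseteq> verts (list_digraph n es).
      card S = k \<and> preserves_strong_connectivity (list_digraph n es) S)}"

end

(*
  Weft-1 circuits of depth d reduce to finding a vertex set of prescribed size that contains no
  member of a given family of forbidden sets, and this in turn to the deletion problem.

  Forbidden sets: put every element on a two-cycle with a root, and for every forbidden set add a
  vertex whose in-neighbours are the elements of the set and whose out-neighbour is the root.
  Replacing the root and the new vertices by long paths makes them undeletable, because deleting
  one vertex of a path forces the deletion of the whole path.  Then the remaining graph is strongly
  connected iff no forbidden set is deleted completely.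

  Circuits: a set of k true inputs is represented by its increasing enumeration, framed by two
  sentinels, with one element per pair (index, value).  The statement "x is true" then means that
  some element with value x is chosen, and "x is false" that two consecutive elements enclose x,
  so both are disjunctions of conjunctions of choices.  Hence a gate below which all fan-ins are at
  most 2 has a DNF of constant size over choices, for either truth value.  As a path to the output
  meets at most one large gate, "the output is true" becomes a disjunction of polynomially many
  alternatives, each of which forbids a list of conjunctions; choosing one further element selects
  the alternative.
*)
theory Submission
  imports Defs
begin

text \<open>A forbidden set can only say that certain elements are not all chosen. So the absence of
  an input must itself be witnessed by chosen elements, which is why the true inputs are listed in
  increasing order: a missing input shows up as a gap between two neighbours, and the sentinels
  supply neighbours at both ends. Pairwise forbidden sets allow at most one element per index and at
  most one alternative; asking for exactly \<open>k + 3\<close> elements, for \<open>k\<close>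
  inputs, two sentinels and one alternative, turns "at most one" into "exactly one". Paths have
  \<open>k + 5\<close> vertices, two more than are deleted: no path can vanish entirely, and at
  least two vertices survive, so strong connectivity is never the trivial one of a single vertex.
  \<open>WCS\<close> contains only well-formed circuits that obey the weft and depth bounds, so the
  reduction has to decide these conditions, and everything must run in polynomial time in a concrete
  WHILE language. Hence a calculus of closure rules for polynomial-time tree functions, in which the
  fixed depth \<open>d\<close> unfolds into nested comprehensions of fixed shape.\<close>

section \<open>Trees as lists\<close>

text \<open>Every tree encodes exactly one list of trees.  Functions on trees are specified through this
  list view, and every tree is read as the number \<open>len\<close> given by the length of its list, so that
  non-canonical inputs need no special treatment.\<close>

lemma dat_size_pos [simp]: "0 < dat_size x"
  by (cases x) auto

fun dl :: "dat \<Rightarrow> dat list" where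
  "dl Nil_dat = []"
| "dl (Pair_dat a b) = a # dl b"

lemma enc_list_dl [simp]: "enc_list (dl x) = x"
  by (induction x) auto

lemma dl_enc_list [simp]: "dl (enc_list xs) = xs"
  by (induction xs) auto

lemma dl_eq_Nil [simp]: "dl x = [] \<longleftrightarrow> x = Nil_dat"
  by (cases x) auto

lemma dl_dat_tl [simp]: "dl (dat_tl x) = tl (dl x)"
  by (cases x) auto

lemma dl_enc_nat [simp]: "dl (enc_nat n) = replicate n Nil_dat"
  by (simp add: enc_nat_def)

lemma enc_nat_simps [simp]:
  "enc_nat 0 = Nil_dat" "enc_nat (Suc n) = Pair_dat Nil_dat (enc_nat n)"
  by (simp_all add: enc_nat_def)

lemma length_dl_less_dat_size: "length (dl x) < dat_size x"
  by (induction x) auto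

lemma dat_size_enc_list: "dat_size (enc_list xs) = 1 + (\<Sum>x\<leftarrow>xs. 1 + dat_size x)"
  by (induction xs) auto

lemma dat_size_enc_nat: "dat_size (enc_nat n) = 2 * n + 1"
  by (induction n) auto

lemma dat_size_hd_le: "dat_size (dat_hd x) \<le> dat_size x"
  by (cases x) auto

lemma dat_size_tl_le: "dat_size (dat_tl x) \<le> dat_size x"
  by (cases x) auto


section \<open>Polynomial bounds\<close>

text \<open>Generated inductively so that monotonicity, closure under composition and computability
  on numerals are plain inductions; a monomial is extracted only when reductions are
  composed.\<close>

inductive poly_bound :: "(nat \<Rightarrow> nat) \<Rightarrow> bool" where
  poly_bound_id: "poly_bound (\<lambda>n. n)"
| poly_bound_const: "poly_bound (\<lambda>n. c)"
| poly_bound_add: "poly_bound f \<Longrightarrow> poly_bound g \<Longrightarrow> poly_bound (\<lambda>n. f n + g n)"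
| poly_bound_mult: "poly_bound f \<Longrightarrow> poly_bound g \<Longrightarrow> poly_bound (\<lambda>n. f n * g n)"

lemma poly_bound_comp: "poly_bound f \<Longrightarrow> poly_bound g \<Longrightarrow> poly_bound (\<lambda>n. f (g n))"
  by (induction f rule: poly_bound.induct) (simp_all add: poly_bound.intros)

lemma poly_bound_mono: "poly_bound f \<Longrightarrow> m \<le> n \<Longrightarrow> f m \<le> f n"
  by (induction f rule: poly_bound.induct) (simp_all add: add_mono mult_mono)

text \<open>One constant serves as coefficient and as exponent. The restriction to positive
  \<open>n\<close>, where powers grow with the exponent, is harmless because tree sizes are
  positive.\<close>

lemma poly_bound_monomial:
  "poly_bound f \<Longrightarrow> \<exists>c. \<forall>n \<ge> 1. f n \<le> c * n ^ c"
proof (induction f rule: poly_bound.induct)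
  case poly_bound_id
  then show ?case by (auto intro!: exI[of _ 1])
next
  case (poly_bound_const c)
  then show ?case by (auto intro!: exI[of _ c])
next
  case (poly_bound_add f g)
  then obtain c d where c: "\<forall>n \<ge> 1. f n \<le> c * n ^ c" and d: "\<forall>n \<ge> 1. g n \<le> d * n ^ d" by blast
  have "f n + g n \<le> (c + d) * n ^ (c + d)" if "n \<ge> 1" for n
  proof -
    have "c * n ^ c \<le> c * n ^ (c + d)" "d * n ^ d \<le> d * n ^ (c + d)"
      using that by (auto intro!: power_increasing)
    with c d that show ?thesis
      unfolding add_mult_distrib by (meson add_mono order_trans)
  qed
  then show ?case by blast
next
  case (poly_bound_mult f g)
  then obtain c d where c: "\<forall>n \<ge> 1. f n \<le> c * n ^ c" and d: "\<forall>n \<ge> 1. g n \<le> d * n ^ d" by blast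
  have "f n * g n \<le> (c + d + c * d) * n ^ (c + d + c * d)" if "n \<ge> 1" for n
  proof -
    have "f n * g n \<le> (c * n ^ c) * (d * n ^ d)" using c d that by (intro mult_mono) auto
    also have "\<dots> = (c * d) * n ^ (c + d)" by (simp add: power_add)
    also have "\<dots> \<le> (c + d + c * d) * n ^ (c + d + c * d)"
      using that by (intro mult_mono power_increasing) auto
    finally show ?thesis .
  qed
  then show ?case by blast
qed


section \<open>Polynomial-time functions\<close>

definition pt_on :: "com \<Rightarrow> nat \<Rightarrow> (dat \<Rightarrow> dat) \<Rightarrow> (nat \<Rightarrow> nat) \<Rightarrow> bool" where
  "pt_on p r f h \<longleftrightarrow> (\<forall>s. \<exists>t s'. exec p s t s' \<and> t \<le> h (dat_size (s r)) \<and>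
     s' r = f (s r) \<and> (\<forall>v < r. s' v = s v))"

text \<open>A program must work in every register; it may overwrite all higher registers but must not
  rely on their initial contents.  So subprograms compose without renaming or clean-up.\<close>

definition pt :: "(dat \<Rightarrow> dat) \<Rightarrow> bool" where
  "pt f \<longleftrightarrow> (\<exists>h. poly_bound h \<and> (\<forall>r. \<exists>p. pt_on p r f h))"

lemma ptI:
  assumes "poly_bound h" and "\<And>r. \<exists>p. pt_on p r f h"
  shows "pt f"
  using assms unfolding pt_def by blast

lemma pt_onE:
  assumes "pt_on p r f h"
  obtains t s' where "exec p s t s'" "t \<le> h (dat_size (s r))" "s' r = f (s r)" "\<And>v. v < r \<Longrightarrow> s' v = s v"
  using assms unfolding pt_on_def by meson

text \<open>An assignment is charged the size of what it stores, so whatever a program writes is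
  paid for by its running time.\<close>

lemma dat_size_exec:
  "exec p s t s' \<Longrightarrow> dat_size (s' v) \<le> max (dat_size (s v)) t"
  by (induction rule: exec.induct) auto

text \<open>Needed for every composition: the second function is charged in terms of the size of the
  intermediate result.\<close>

lemma pt_size:
  assumes "pt f"
  obtains h where "poly_bound h" "\<And>x. dat_size (f x) \<le> h (dat_size x)"
proof -
  from assms obtain h p where h: "poly_bound h" and p: "pt_on p 0 f h" unfolding pt_def by blast
  have "dat_size (f x) \<le> dat_size x + h (dat_size x)" for x
  proof -
    from p obtain t s' where "exec p (\<lambda>_. x) t s'" "t \<le> h (dat_size x)" "s' 0 = f x"
      by (rule pt_onE[where s = "\<lambda>_. x"]) 
    with dat_size_exec[of p "\<lambda>_. x" t s' 0] show ?thesis by auto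
  qed
  then show thesis by (rule that[OF poly_bound_add[OF poly_bound_id h]])
qed

lemma exec_Assign': "t = 1 + dat_size (expr_val e s) \<Longrightarrow> s' = s(v := expr_val e s) \<Longrightarrow> exec (Assign v e) s t s'"
  using exec.Assign by simp

lemma pt_id [intro!]: "pt (\<lambda>x. x)"
proof (rule ptI)
  show "poly_bound (\<lambda>n. 1)" by (rule poly_bound_const)
  show "\<exists>p. pt_on p r (\<lambda>x. x) (\<lambda>n. 1)" for r
    unfolding pt_on_def using exec.Skip by (metis order_refl)
qed

lemma pt_comp:
  assumes "pt f" "pt g" shows "pt (\<lambda>x. f (g x))"
proof -
  from assms obtain hf hg where h: "poly_bound hf" "poly_bound hg"
    and f: "\<And>r. \<exists>p. pt_on p r f hf" and g: "\<And>r. \<exists>p. pt_on p r g hg" unfolding pt_def by blast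
  from \<open>pt g\<close> obtain b where b: "poly_bound b" "\<And>x. dat_size (g x) \<le> b (dat_size x)" by (rule pt_size) blast
  show ?thesis
  proof (rule ptI)
    show "poly_bound (\<lambda>n. hg n + hf (b n))" by (intro poly_bound_add poly_bound_comp[OF h(1) b(1)] h)
    fix r
    obtain p q where p: "pt_on p r f hf" and q: "pt_on q r g hg" using f g by blast
    have "pt_on (Seq q p) r (\<lambda>x. f (g x)) (\<lambda>n. hg n + hf (b n))"
      unfolding pt_on_def
    proof
      fix s :: store
      from q obtain t s' where 1: "exec q s t s'" "t \<le> hg (dat_size (s r))" "s' r = g (s r)" "\<And>v. v < r \<Longrightarrow> s' v = s v"
        by (rule pt_onE[where s = s]) blast
      from p obtain t' s'' where 2: "exec p s' t' s''" "t' \<le> hf (dat_size (s' r))" "s'' r = f (s' r)" "\<And>v. v < r \<Longrightarrow> s'' v = s' v"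
        by (rule pt_onE[where s = s']) blast
      have "t' \<le> hf (b (dat_size (s r)))" using 2(2) 1(3) b(2) poly_bound_mono[OF h(1)] by (metis order_trans)
      have "exec (Seq q p) s (t + t') s''" by (rule exec.Seq[OF 1(1) 2(1)])
      moreover have "t' \<le> hf (b (dat_size (s r)))" by fact
      ultimately show "\<exists>t s'. exec (Seq q p) s t s' \<and> t \<le> hg (dat_size (s r)) + hf (b (dat_size (s r))) \<and> s' r = f (g (s r)) \<and> (\<forall>v<r. s' v = s v)"
        using 1 2 by - (intro exI conjI, assumption, auto)
    qed
    then show "\<exists>p. pt_on p r (\<lambda>x. f (g x)) (\<lambda>n. hg n + hf (b n))" by (rule exI)
  qed
qed

lemma pt_assign:
  assumes "poly_bound h" and "\<And>r s. expr_val (e r) s = f (s r)" and "\<And>x. dat_size (f x) \<le> h (dat_size x)"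
  shows "pt f"
proof (rule ptI)
  show "poly_bound (\<lambda>n. 1 + h n)" using assms by (intro poly_bound_add poly_bound_const)
  show "\<exists>p. pt_on p r f (\<lambda>n. 1 + h n)" for r
    unfolding pt_on_def
    by (rule exI[of _ "Assign r (e r)"]) (use assms in \<open>force intro!: exec_Assign'\<close>)
qed

fun const_expr :: "dat \<Rightarrow> expr" where
  "const_expr Nil_dat = NilE"
| "const_expr (Pair_dat a b) = ConsE (const_expr a) (const_expr b)"

lemma expr_val_const_expr [simp]: "expr_val (const_expr c) s = c"
  by (induction c) auto

lemma pt_const [intro!]: "pt (\<lambda>x. c)"
  by (rule pt_assign[where h = "\<lambda>_. dat_size c" and e = "\<lambda>_. const_expr c"]) (auto intro: poly_bound_const)

lemma pt_hd [intro!]: "pt f \<Longrightarrow> pt (\<lambda>x. dat_hd (f x))"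
  by (rule pt_comp[of dat_hd], rule pt_assign[where h = "\<lambda>n. n" and e = "\<lambda>r. HdE (Var r)"])
    (auto intro: poly_bound_id dat_size_hd_le)

lemma pt_tl [intro!]: "pt f \<Longrightarrow> pt (\<lambda>x. dat_tl (f x))"
  by (rule pt_comp[of dat_tl], rule pt_assign[where h = "\<lambda>n. n" and e = "\<lambda>r. TlE (Var r)"])
    (auto intro: poly_bound_id dat_size_tl_le)

lemma pt_Pair [intro!]:
  assumes "pt f" "pt g" shows "pt (\<lambda>x. Pair_dat (f x) (g x))"
proof -
  from assms obtain hf hg where h: "poly_bound hf" "poly_bound hg"
    and f: "\<And>r. \<exists>p. pt_on p r f hf" and g: "\<And>r. \<exists>p. pt_on p r g hg" unfolding pt_def by blast
  from \<open>pt f\<close> obtain a where a: "poly_bound a" "\<And>x. dat_size (f x) \<le> a (dat_size x)" by (rule pt_size) blast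
  from \<open>pt g\<close> obtain b where b: "poly_bound b" "\<And>x. dat_size (g x) \<le> b (dat_size x)" by (rule pt_size) blast
  let ?h = "\<lambda>n. (1 + n) + (hf n + ((1 + n) + (hg n + (2 + (a n + b n)))))"
  show ?thesis
  proof (rule ptI)
    show "poly_bound ?h" using h a b by (intro poly_bound_add poly_bound_const poly_bound_id)
    fix r
    obtain p q where p: "pt_on p (r + 1) f hf" and q: "pt_on q (r + 2) g hg" using f g by blast
    \<comment> \<open>The second component is computed in register \<open>r + 2\<close>, so the
      first result waiting in \<open>r + 1\<close> is protected by the frame condition of
      \<open>pt_on\<close>.\<close>
    let ?p = "Seq (Assign (r + 1) (Var r)) (Seq p (Seq (Assign (r + 2) (Var r)) (Seq q
      (Assign r (ConsE (Var (r + 1)) (Var (r + 2)))))))"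
    have "pt_on ?p r (\<lambda>x. Pair_dat (f x) (g x)) ?h"
      unfolding pt_on_def
    proof
      fix s :: store
      let ?s1 = "s(r + 1 := s r)"
      from p obtain t s2 where 1: "exec p ?s1 t s2" "t \<le> hf (dat_size (s r))" "s2 (r + 1) = f (s r)" "\<And>v. v < r + 1 \<Longrightarrow> s2 v = ?s1 v"
        by (rule pt_onE[where s = ?s1]) simp
      let ?s3 = "s2(r + 2 := s r)"
      from q obtain t' s4 where 2: "exec q ?s3 t' s4" "t' \<le> hg (dat_size (s r))" "s4 (r + 2) = g (s r)" "\<And>v. v < r + 2 \<Longrightarrow> s4 v = ?s3 v"
        by (rule pt_onE[where s = ?s3]) simp
      have s2r: "s2 r = s r" using 1(4)[of r] by simp
      have s4: "s4 (r + 1) = f (s r)" using 2(4)[of "r + 1"] 1(3) by simp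
      let ?t5 = "1 + dat_size (Pair_dat (f (s r)) (g (s r)))"
      let ?s5 = "s4(r := Pair_dat (f (s r)) (g (s r)))"
      have "exec ?p s ((1 + dat_size (s r)) + (t + ((1 + dat_size (s r)) + (t' + ?t5)))) ?s5"
        by (intro exec.Seq[OF _ exec.Seq[OF 1(1) exec.Seq[OF _ exec.Seq[OF 2(1)]]]])
          (rule exec_Assign'; use s2r s4 2(3) in simp)+
      moreover have "?t5 \<le> 2 + (a (dat_size (s r)) + b (dat_size (s r)))"
        using a(2)[of "s r"] b(2)[of "s r"] by simp
      moreover have "?s5 v = s v" if "v < r" for v using that 1(4)[of v] 2(4)[of v] by simp
      ultimately show "\<exists>t s'. exec ?p s t s' \<and> t \<le> ?h (dat_size (s r)) \<and> s' r = Pair_dat (f (s r)) (g (s r)) \<and> (\<forall>v<r. s' v = s v)"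
        using 1(2) 2(2) by - (intro exI conjI, assumption, auto)
    qed
    then show "\<exists>p. pt_on p r (\<lambda>x. Pair_dat (f x) (g x)) ?h" by (rule exI)
  qed
qed

section \<open>Truth values and polynomial-time predicates\<close>

definition tt :: dat where "tt = Pair_dat Nil_dat Nil_dat"

lemma tt_neq_Nil [simp]: "tt \<noteq> Nil_dat" "Nil_dat \<noteq> tt"
  by (simp_all add: tt_def)

definition dbool :: "bool \<Rightarrow> dat" where "dbool b = (if b then tt else Nil_dat)"

lemma dbool_eq_Nil [simp]: "dbool b = Nil_dat \<longleftrightarrow> \<not> b"
  by (simp add: dbool_def)

definition pp :: "(dat \<Rightarrow> bool) \<Rightarrow> bool" where "pp P \<longleftrightarrow> pt (\<lambda>x. dbool (P x))"

lemma pt_dbool [intro!]: "pp P \<Longrightarrow> pt (\<lambda>x. dbool (P x))"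
  by (simp add: pp_def)

lemma pt_if_Nil:
  assumes "pt e" "pt f" "pt g" shows "pt (\<lambda>x. if e x \<noteq> Nil_dat then f x else g x)"
proof -
  from assms obtain he hf hg where h: "poly_bound he" "poly_bound hf" "poly_bound hg"
    and e: "\<And>r. \<exists>p. pt_on p r e he"
    and f: "\<And>r. \<exists>p. pt_on p r f hf" and g: "\<And>r. \<exists>p. pt_on p r g hg" unfolding pt_def by blast
  let ?h = "\<lambda>n. (1 + n) + (he n + (1 + (hf n + hg n)))"
  show ?thesis
  proof (rule ptI)
    show "poly_bound ?h" using h by (intro poly_bound_add poly_bound_const poly_bound_id)
    fix r
    obtain d p q where d: "pt_on d (r + 1) e he" and p: "pt_on p r f hf" and q: "pt_on q r g hg"
      using e f g by blast
    let ?p = "Seq (Assign (r + 1) (Var r)) (Seq d (If (Var (r + 1)) p q))"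
    have "pt_on ?p r (\<lambda>x. if e x \<noteq> Nil_dat then f x else g x) ?h"
      unfolding pt_on_def
    proof
      fix s :: store
      let ?s1 = "s(r + 1 := s r)"
      have 0: "exec (Assign (r + 1) (Var r)) s (1 + dat_size (s r)) ?s1" by (rule exec_Assign') auto
      from d obtain t s2 where 1: "exec d ?s1 t s2" "t \<le> he (dat_size (s r))" "s2 (r + 1) = e (s r)" "\<And>v. v < r + 1 \<Longrightarrow> s2 v = ?s1 v"
        by (rule pt_onE[where s = ?s1]) simp
      have 2: "s2 v = s v" if "v \<le> r" for v using 1(4)[of v] that by simp
      show "\<exists>t s'. exec ?p s t s' \<and> t \<le> ?h (dat_size (s r)) \<and> s' r = (if e (s r) \<noteq> Nil_dat then f (s r) else g (s r)) \<and> (\<forall>v<r. s' v = s v)"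
      proof (cases "e (s r) = Nil_dat")
        case True
        from q obtain t' s4 where 3: "exec q s2 t' s4" "t' \<le> hg (dat_size (s2 r))" "s4 r = g (s2 r)" "\<And>v. v < r \<Longrightarrow> s4 v = s2 v"
          by (rule pt_onE[where s = s2]) simp
        have "exec ?p s ((1 + dat_size (s r)) + (t + (1 + t'))) s4"
          by (intro exec.Seq[OF 0] exec.Seq[OF 1(1)] exec.IfFalse 3(1)) (use 1(3) True in simp)
        then show ?thesis using 1(2) 3 2 True by - (intro exI conjI, assumption, auto)
      next
        case False
        from p obtain t' s4 where 3: "exec p s2 t' s4" "t' \<le> hf (dat_size (s2 r))" "s4 r = f (s2 r)" "\<And>v. v < r \<Longrightarrow> s4 v = s2 v"
          by (rule pt_onE[where s = s2]) simp
        have "exec ?p s ((1 + dat_size (s r)) + (t + (1 + t'))) s4"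
          by (intro exec.Seq[OF 0] exec.Seq[OF 1(1)] exec.IfTrue 3(1)) (use 1(3) False in simp)
        then show ?thesis using 1(2) 3 2 False by - (intro exI conjI, assumption, auto)
      qed
    qed
    then show "\<exists>p. pt_on p r (\<lambda>x. if e x \<noteq> Nil_dat then f x else g x) ?h" by (rule exI)
  qed
qed

lemma pt_if [intro!]: "pp P \<Longrightarrow> pt f \<Longrightarrow> pt g \<Longrightarrow> pt (\<lambda>x. if P x then f x else g x)"
  using pt_if_Nil[of "\<lambda>x. dbool (P x)" f g] by (simp add: pp_def)

lemma pp_const [intro!]: "pp (\<lambda>x. b)"
  unfolding pp_def by (rule pt_const)

lemma pp_Nil [intro!]:
  assumes "pt f" shows "pp (\<lambda>x. f x = Nil_dat)"
proof -
  have "(\<lambda>x. dbool (f x = Nil_dat)) = (\<lambda>x. if f x \<noteq> Nil_dat then Nil_dat else tt)"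
    by (auto simp: dbool_def)
  then show ?thesis unfolding pp_def using assms by (simp only: pt_if_Nil pt_const)
qed

lemma pp_if:
  assumes "pp P" "pp Q" "pp R" shows "pp (\<lambda>x. if P x then Q x else R x)"
proof -
  have "(\<lambda>x. dbool (if P x then Q x else R x)) = (\<lambda>x. if P x then dbool (Q x) else dbool (R x))"
    by auto
  then show ?thesis unfolding pp_def using assms by (simp only: pt_if pt_dbool)
qed

lemma pp_not [intro!]:
  assumes "pp P" shows "pp (\<lambda>x. \<not> P x)"
  using pp_Nil[OF pt_dbool[OF assms]] by simp

lemma pp_conj [intro!]:
  assumes "pp P" "pp Q" shows "pp (\<lambda>x. P x \<and> Q x)"
proof -
  have "(\<lambda>x. P x \<and> Q x) = (\<lambda>x. if P x then Q x else False)" by auto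
  then show ?thesis using assms by (simp only: pp_if pp_const)
qed

lemma pp_disj [intro!]:
  assumes "pp P" "pp Q" shows "pp (\<lambda>x. P x \<or> Q x)"
proof -
  have "(\<lambda>x. P x \<or> Q x) = (\<lambda>x. if P x then True else Q x)" by auto
  then show ?thesis using assms by (simp only: pp_if pp_const)
qed

lemma pp_eq [intro!]:
  assumes "pp P" "pp Q" shows "pp (\<lambda>x. P x = Q x)"
proof -
  have "(\<lambda>x. P x = Q x) = (\<lambda>x. if P x then Q x else \<not> Q x)" by auto
  then show ?thesis using assms by (simp only: pp_if pp_not)
qed

text \<open>Iterating a polynomial-time step may blow up exponentially, so a polynomial bound on the
  accumulator after every prefix of the list is a hypothesis. The step receives accumulator, element
  and the whole original input, packed as a triple.\<close>

lemma pt_fold: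
  assumes "pt L" "pt A" and G: "pt (\<lambda>z. F (dat_hd z) (dat_hd (dat_tl z)) (dat_tl (dat_tl z)))"
    and B: "poly_bound B"
    and B': "\<And>x ys zs. dl (L x) = ys @ zs \<Longrightarrow> dat_size (foldl (\<lambda>a y. F a y x) (A x) ys) \<le> B (dat_size x)"
  shows "pt (\<lambda>x. foldl (\<lambda>a y. F a y x) (A x) (dl (L x)))"
proof -
  from assms obtain hL hA hG where h: "poly_bound hL" "poly_bound hA" "poly_bound hG"
    and eL: "\<And>r. \<exists>p. pt_on p r L hL" and eA: "\<And>r. \<exists>p. pt_on p r A hA"
    and eG: "\<And>r. \<exists>p. pt_on p r (\<lambda>z. F (dat_hd z) (dat_hd (dat_tl z)) (dat_tl (dat_tl z))) hG"
    unfolding pt_def by blast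
  from \<open>pt L\<close> obtain l where l: "poly_bound l" "\<And>x. dat_size (L x) \<le> l (dat_size x)" by (rule pt_size) blast
  \<comment> \<open>\<open>Z\<close> bounds the triple handed to the step, with 2 for its two pair
    nodes; \<open>W\<close> bounds one pass through the loop body.\<close>
  define Z where "Z = (\<lambda>n. 2 + (B n + (l n + n)))"
  define W where "W = (\<lambda>n. (1 + Z n) + (hG (Z n) + ((1 + B n) + (1 + l n))))"
  have Z: "poly_bound Z" unfolding Z_def by (intro poly_bound_add poly_bound_const poly_bound_id B l)
  have W: "poly_bound W" unfolding W_def
    by (intro poly_bound_add poly_bound_const Z B l(1) poly_bound_comp[OF h(3) Z])
  let ?h = "\<lambda>n. (1 + n) + (hL n + ((1 + n) + (hA n + ((1 + l n * (1 + W n)) + (1 + B n)))))"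
  show ?thesis
  proof (rule ptI)
    show "poly_bound ?h" by (intro poly_bound_add poly_bound_mult poly_bound_const poly_bound_id W B l h)
    fix r
    obtain pL pA pG where pL: "pt_on pL (r + 1) L hL" and pA: "pt_on pA (r + 2) A hA"
      and pG: "pt_on pG (r + 3) (\<lambda>z. F (dat_hd z) (dat_hd (dat_tl z)) (dat_tl (dat_tl z))) hG"
      using eL eA eG by blast
    define body where "body = Seq (Assign (r + 3) (ConsE (Var (r + 2)) (ConsE (HdE (Var (r + 1))) (Var r))))
      (Seq pG (Seq (Assign (r + 2) (Var (r + 3))) (Assign (r + 1) (TlE (Var (r + 1))))))"
    \<comment> \<open>Register \<open>r\<close> keeps the input, \<open>r + 1\<close> holds the rest
      of the list and \<open>r + 2\<close> the accumulator. The prefix bound passes to the tail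
      because folding the new accumulator over \<open>us\<close> is folding the old one over
      \<open>y # us\<close>.\<close>
    have loop: "\<exists>t s'. exec (While (Var (r + 1)) body) s t s' \<and> t \<le> 1 + length ys * (1 + W (dat_size x)) \<and>
        s' (r + 2) = foldl (\<lambda>a y. F a y x) (s (r + 2)) ys \<and> (\<forall>v \<le> r. s' v = s v)"
      if "s r = x" "s (r + 1) = enc_list ys" "dat_size (s (r + 1)) \<le> l (dat_size x)"
        "\<And>us vs. ys = us @ vs \<Longrightarrow> dat_size (foldl (\<lambda>a y. F a y x) (s (r + 2)) us) \<le> B (dat_size x)"
      for s ys x
      using that
    proof (induction ys arbitrary: s)
      case Nil
      then show ?case using exec.WhileFalse[of "Var (r + 1)" s body] by (intro exI[of _ 1] exI[of _ s]) auto
    next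
      case (Cons y ys)
      let ?n = "dat_size x"
      let ?z = "Pair_dat (s (r + 2)) (Pair_dat y x)"
      let ?s1 = "s(r + 3 := ?z)"
      have 0: "exec (Assign (r + 3) (ConsE (Var (r + 2)) (ConsE (HdE (Var (r + 1))) (Var r)))) s (1 + dat_size ?z) ?s1"
        by (rule exec_Assign') (use Cons.prems in auto)
      have "dat_size (s (r + 2)) \<le> B ?n" using Cons.prems(4)[of "[]"] by simp
      moreover have y: "dat_size y \<le> l ?n" "dat_size (enc_list ys) \<le> l ?n" using Cons.prems(2,3) by simp_all
      ultimately have z: "dat_size ?z \<le> Z ?n" by (simp add: Z_def)
      from pG obtain t s2 where 1: "exec pG ?s1 t s2" "t \<le> hG (dat_size ?z)"
        "s2 (r + 3) = F (s (r + 2)) y x" "\<And>v. v < r + 3 \<Longrightarrow> s2 v = ?s1 v"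
        by (rule pt_onE[where s = ?s1]) simp
      have t: "t \<le> hG (Z ?n)" using 1(2) z poly_bound_mono[OF h(3)] by (meson order_trans)
      let ?a = "F (s (r + 2)) y x"
      let ?s3 = "s2(r + 2 := ?a)"
      let ?s4 = "?s3(r + 1 := enc_list ys)"
      have s2: "s2 (r + 1) = Pair_dat y (enc_list ys)" using 1(4)[of "r + 1"] Cons.prems(2) by simp
      have a: "dat_size ?a \<le> B ?n" using Cons.prems(4)[of "[y]" ys] by simp
      have b: "exec body s ((1 + dat_size ?z) + (t + ((1 + dat_size ?a) + (1 + dat_size (enc_list ys))))) ?s4"
        unfolding body_def
        by (rule exec.Seq[OF 0 exec.Seq[OF 1(1) exec.Seq]]; rule exec_Assign') (use 1(3) s2 in auto)
      have agree: "?s4 v = s v" if "v \<le> r" for v using that 1(4)[of v] by simp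
      have "\<exists>t s'. exec (While (Var (r + 1)) body) ?s4 t s' \<and> t \<le> 1 + length ys * (1 + W ?n) \<and>
        s' (r + 2) = foldl (\<lambda>a y. F a y x) (?s4 (r + 2)) ys \<and> (\<forall>v \<le> r. s' v = ?s4 v)"
      proof (rule Cons.IH)
        show "?s4 r = x" using agree[of r] Cons.prems(1) by simp
        show "dat_size (foldl (\<lambda>a y. F a y x) (?s4 (r + 2)) us) \<le> B ?n" if "ys = us @ vs" for us vs
          using Cons.prems(4)[of "y # us" vs] that by simp
      qed (use y in auto)
      then obtain t' s5 where 5: "exec (While (Var (r + 1)) body) ?s4 t' s5" "t' \<le> 1 + length ys * (1 + W ?n)"
        "s5 (r + 2) = foldl (\<lambda>a y. F a y x) ?a ys" "\<And>v. v \<le> r \<Longrightarrow> s5 v = ?s4 v" by auto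
      have "(1 + dat_size ?z) + (t + ((1 + dat_size ?a) + (1 + dat_size (enc_list ys)))) \<le> W ?n"
        unfolding W_def using z t a y(2) by linarith
      moreover have "exec (While (Var (r + 1)) body) s
        (1 + ((1 + dat_size ?z) + (t + ((1 + dat_size ?a) + (1 + dat_size (enc_list ys))))) + t') s5"
        by (rule exec.WhileTrue[OF _ b 5(1)]) (use Cons.prems(2) in simp)
      ultimately show ?case using 5 agree
        by - (intro exI conjI, assumption, auto)
    qed
    let ?p = "Seq (Assign (r + 1) (Var r)) (Seq pL (Seq (Assign (r + 2) (Var r)) (Seq pA
      (Seq (While (Var (r + 1)) body) (Assign r (Var (r + 2)))))))"
    have "pt_on ?p r (\<lambda>x. foldl (\<lambda>a y. F a y x) (A x) (dl (L x))) ?h"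
      unfolding pt_on_def
    proof
      fix s :: store
      let ?x = "s r"
      let ?n = "dat_size ?x"
      let ?f = "\<lambda>ys. foldl (\<lambda>a y. F a y ?x) (A ?x) ys"
      let ?s1 = "s(r + 1 := s r)"
      have 0: "exec (Assign (r + 1) (Var r)) s (1 + ?n) ?s1" by (rule exec_Assign') auto
      from pL obtain t1 s2 where 1: "exec pL ?s1 t1 s2" "t1 \<le> hL ?n" "s2 (r + 1) = L ?x" "\<And>v. v < r + 1 \<Longrightarrow> s2 v = ?s1 v"
        by (rule pt_onE[where s = ?s1]) simp
      have s2: "s2 v = s v" if "v \<le> r" for v using that 1(4)[of v] by simp
      let ?s3 = "s2(r + 2 := s r)"
      have 2: "exec (Assign (r + 2) (Var r)) s2 (1 + ?n) ?s3" by (rule exec_Assign') (use s2 in auto)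
      from pA obtain t2 s4 where 3: "exec pA ?s3 t2 s4" "t2 \<le> hA ?n" "s4 (r + 2) = A ?x" "\<And>v. v < r + 2 \<Longrightarrow> s4 v = ?s3 v"
        by (rule pt_onE[where s = ?s3]) simp
      have s4: "s4 v = s v" if "v \<le> r" for v using that 3(4)[of v] s2 by simp
      have "\<exists>t s'. exec (While (Var (r + 1)) body) s4 t s' \<and> t \<le> 1 + length (dl (L ?x)) * (1 + W ?n) \<and>
        s' (r + 2) = foldl (\<lambda>a y. F a y ?x) (s4 (r + 2)) (dl (L ?x)) \<and> (\<forall>v \<le> r. s' v = s4 v)"
        by (rule loop) (use s4 3(3) 3(4)[of "r + 1"] 1(3) l B' in auto)
      then obtain t3 s5 where 5: "exec (While (Var (r + 1)) body) s4 t3 s5" "t3 \<le> 1 + length (dl (L ?x)) * (1 + W ?n)"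
        "s5 (r + 2) = ?f (dl (L ?x))" "\<And>v. v \<le> r \<Longrightarrow> s5 v = s4 v" using 3(3) by auto
      have "length (dl (L ?x)) \<le> l ?n" using length_dl_less_dat_size[of "L ?x"] l(2)[of ?x] by linarith
      then have "length (dl (L ?x)) * (1 + W ?n) \<le> l ?n * (1 + W ?n)" by (rule mult_right_mono) simp
      with 5(2) have t3: "t3 \<le> 1 + l ?n * (1 + W ?n)" by linarith
      let ?s6 = "s5(r := ?f (dl (L ?x)))"
      have 6: "exec (Assign r (Var (r + 2))) s5 (1 + dat_size (?f (dl (L ?x)))) ?s6"
        by (rule exec_Assign') (use 5 in auto)
      have 7: "dat_size (?f (dl (L ?x))) \<le> B ?n" using B'[of ?x "dl (L ?x)" "[]"] by simp
      have "exec ?p s ((1 + ?n) + (t1 + ((1 + ?n) + (t2 + (t3 + (1 + dat_size (?f (dl (L ?x))))))))) ?s6"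
        by (intro exec.Seq[OF 0] exec.Seq[OF 1(1)] exec.Seq[OF 2] exec.Seq[OF 3(1)] exec.Seq[OF 5(1)] 6)
      moreover have "(1 + ?n) + (t1 + ((1 + ?n) + (t2 + (t3 + (1 + dat_size (?f (dl (L ?x)))))))) \<le> ?h ?n"
        using 1(2) 3(2) t3 7 by linarith
      moreover have "?s6 v = s v" if "v < r" for v using that 5(4)[of v] s4[of v] by simp
      ultimately show "\<exists>t s'. exec ?p s t s' \<and> t \<le> ?h ?n \<and> s' r = ?f (dl (L ?x)) \<and> (\<forall>v<r. s' v = s v)"
        by - (intro exI conjI, assumption, auto)
    qed
    then show "\<exists>p. pt_on p r (\<lambda>x. foldl (\<lambda>a y. F a y x) (A x) (dl (L x))) ?h" by (rule exI)
  qed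
qed

section \<open>List operations on trees\<close>

definition drev :: "dat \<Rightarrow> dat \<Rightarrow> dat" where
  "drev a l = foldl (\<lambda>a y. Pair_dat y a) a (dl l)"

lemma dl_drev [simp]: "dl (drev a l) = rev (dl l) @ dl a"
proof -
  have "dl (foldl (\<lambda>a y. Pair_dat y a) a ys) = rev ys @ dl a" for ys
    by (induction ys arbitrary: a) auto
  then show ?thesis by (simp add: drev_def)
qed

lemma dat_size_dl: "dat_size x = 1 + (\<Sum>y\<leftarrow>dl x. 1 + dat_size y)"
  using dat_size_enc_list[of "dl x"] by simp

lemma pt_drev [intro!]:
  assumes "pt A" "pt L" shows "pt (\<lambda>x. drev (A x) (L x))"
proof -
  from \<open>pt A\<close> obtain a where a: "poly_bound a" "\<And>x. dat_size (A x) \<le> a (dat_size x)" by (rule pt_size) blast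
  from \<open>pt L\<close> obtain l where l: "poly_bound l" "\<And>x. dat_size (L x) \<le> l (dat_size x)" by (rule pt_size) blast
  show ?thesis
    unfolding drev_def
  proof (rule pt_fold[where F = "\<lambda>a y x. Pair_dat y a", OF \<open>pt L\<close> \<open>pt A\<close>])
    show "poly_bound (\<lambda>n. a n + l n)" using a l by (intro poly_bound_add)
    fix x ys zs assume *: "dl (L x) = ys @ zs"
    have "dat_size (foldl (\<lambda>a y. Pair_dat y a) a ys) = dat_size a + (\<Sum>y\<leftarrow>ys. 1 + dat_size y)" for a
      by (induction ys arbitrary: a) auto
    moreover have "dat_size (L x) \<ge> (\<Sum>y\<leftarrow>ys. 1 + dat_size y)"
      using * by (subst dat_size_dl) simp
    ultimately show "dat_size (foldl (\<lambda>a y. Pair_dat y a) (A x) ys) \<le> a (dat_size x) + l (dat_size x)"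
      using a(2)[of x] l(2)[of x] by simp
  qed auto
qed

definition dbind :: "dat \<Rightarrow> (dat \<Rightarrow> dat) \<Rightarrow> dat" where
  "dbind l F = enc_list (concat (map (\<lambda>y. dl (F y)) (dl l)))"

lemma dl_dbind [simp]: "dl (dbind l F) = concat (map (\<lambda>y. dl (F y)) (dl l))"
  by (simp add: dbind_def)

text \<open>Results are pushed in reverse by \<open>drev\<close>, and one reversal at the end
  restores the order. At most \<open>l n\<close> pieces, each of polynomial size, keep the
  accumulator small. The body may use the whole input \<open>x\<close>, which is what makes nested
  comprehensions possible.\<close>

lemma pt_dbind [intro!]:
  assumes L: "pt L" and F: "pt (\<lambda>z. F (dat_hd z) (dat_tl z))"
  shows "pt (\<lambda>x. dbind (L x) (\<lambda>y. F y x))"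
proof -
  let ?f = "\<lambda>x ys. foldl (\<lambda>a y. drev a (F y x)) Nil_dat ys"
  have f: "?f x ys = enc_list (rev (concat (map (\<lambda>y. dl (F y x)) ys)))" for x ys
  proof -
    have "dl (foldl (\<lambda>a y. drev a (F y x)) a ys) = rev (concat (map (\<lambda>y. dl (F y x)) ys)) @ dl a" for a
      by (induction ys arbitrary: a) auto
    from this[of Nil_dat] show ?thesis by (metis append_Nil2 dl.simps(1) enc_list_dl)
  qed
  from L obtain l where l: "poly_bound l" "\<And>x. dat_size (L x) \<le> l (dat_size x)" by (rule pt_size) blast
  from F obtain b where b: "poly_bound b" "\<And>z. dat_size (F (dat_hd z) (dat_tl z)) \<le> b (dat_size z)"
    by (rule pt_size) blast
  let ?B = "\<lambda>n. 1 + l n * b (1 + (l n + n))"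
  have "pt (\<lambda>x. ?f x (dl (L x)))"
  proof (rule pt_fold[where F = "\<lambda>a y x. drev a (F y x)", OF L])
    show "pt (\<lambda>z. drev (dat_hd z) (F (dat_hd (dat_tl z)) (dat_tl (dat_tl z))))"
      by (intro pt_drev pt_hd pt_comp[OF F, of dat_tl] pt_tl pt_id)
    show "poly_bound ?B"
      by (intro poly_bound_add poly_bound_mult poly_bound_comp[OF b(1)] poly_bound_const poly_bound_id l(1))
    fix x ys zs assume *: "dl (L x) = ys @ zs"
    have "(\<Sum>v\<leftarrow>concat (map (\<lambda>y. dl (F y x)) ys). 1 + dat_size v) \<le> length ys * b (1 + (l (dat_size x) + dat_size x))"
      if "set ys \<subseteq> set (dl (L x))" using that
    proof (induction ys)
      case (Cons y ys)
      have "(\<Sum>v\<leftarrow>dl (F y x). 1 + dat_size v) \<le> dat_size (F y x)" by (subst (2) dat_size_dl) simp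
      also have "\<dots> \<le> b (dat_size (Pair_dat y x))" using b(2)[of "Pair_dat y x"] by simp
      also have "dat_size y < dat_size (L x)"
      proof -
        have "1 + dat_size y \<in> set (map (\<lambda>y. 1 + dat_size y) (dl (L x)))" using Cons.prems by auto
        then have "1 + dat_size y \<le> (\<Sum>y\<leftarrow>dl (L x). 1 + dat_size y)" by (rule member_le_sum_list) simp
        then show ?thesis by (subst dat_size_dl) simp
      qed
      then have "b (dat_size (Pair_dat y x)) \<le> b (1 + (l (dat_size x) + dat_size x))"
        using l(2)[of x] by (intro poly_bound_mono[OF b(1)]) simp
      finally show ?case using Cons by simp
    qed simp
    also have "length ys \<le> l (dat_size x)"
      using * length_dl_less_dat_size[of "L x"] l(2)[of x] by simp
    then have "length ys * b (1 + (l (dat_size x) + dat_size x)) \<le> l (dat_size x) * b (1 + (l (dat_size x) + dat_size x))"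
      by (rule mult_right_mono) simp
    finally show "dat_size (?f x ys) \<le> ?B (dat_size x)"
      using * by (simp add: f dat_size_enc_list rev_map[symmetric])
  qed auto
  then have "pt (\<lambda>x. drev Nil_dat (?f x (dl (L x))))" by (intro pt_drev pt_const)
  moreover have "drev Nil_dat (?f x (dl (L x))) = dbind (L x) (\<lambda>y. F y x)" for x
  proof -
    have "dl (drev Nil_dat (?f x (dl (L x)))) = dl (dbind (L x) (\<lambda>y. F y x))" by (simp add: f)
    then show ?thesis by (metis enc_list_dl)
  qed
  ultimately show ?thesis by simp
qed

definition dapp :: "dat \<Rightarrow> dat \<Rightarrow> dat" where
  "dapp a b = drev b (drev Nil_dat a)"

lemma dl_dapp [simp]: "dl (dapp a b) = dl a @ dl b"
  by (simp add: dapp_def)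

lemma pt_dapp [intro!]: "pt A \<Longrightarrow> pt B \<Longrightarrow> pt (\<lambda>x. dapp (A x) (B x))"
  unfolding dapp_def by (intro pt_drev pt_const)

definition ddrop :: "dat \<Rightarrow> dat \<Rightarrow> dat" where
  "ddrop l i = foldl (\<lambda>a y. dat_tl a) l (dl i)"

lemma dl_ddrop [simp]: "dl (ddrop l i) = drop (length (dl i)) (dl l)"
proof -
  have "dl (foldl (\<lambda>a y. dat_tl a) l ys) = drop (length ys) (dl l)" for ys
    by (induction ys arbitrary: l) (auto simp: drop_Suc)
  then show ?thesis by (simp add: ddrop_def)
qed

lemma pt_ddrop [intro!]:
  assumes "pt L" "pt I" shows "pt (\<lambda>x. ddrop (L x) (I x))"
proof -
  from \<open>pt L\<close> obtain l where l: "poly_bound l" "\<And>x. dat_size (L x) \<le> l (dat_size x)" by (rule pt_size) blast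
  show ?thesis
    unfolding ddrop_def
  proof (rule pt_fold[where F = "\<lambda>a y x. dat_tl a", OF \<open>pt I\<close> \<open>pt L\<close>])
    show "poly_bound l" by fact
    fix x ys
    have "dat_size (foldl (\<lambda>a y. dat_tl a) a ys) \<le> dat_size a" for a
      by (induction ys arbitrary: a) (auto intro: order_trans[OF _ dat_size_tl_le])
    then show "dat_size (foldl (\<lambda>a y. dat_tl a) (L x) ys) \<le> l (dat_size x)"
      using l(2) order_trans by blast
  qed auto
qed

definition len :: "dat \<Rightarrow> nat" where "len x = length (dl x)"

lemma len_simps [simp]:
  "len Nil_dat = 0" "len (Pair_dat a b) = Suc (len b)" "len (enc_nat n) = n"
  "len (dat_tl x) = len x - 1" "len (dapp x y) = len x + len y" "len (enc_list xs) = length xs"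
  by (simp_all add: len_def)

lemma pp_le [intro!]:
  assumes "pt f" "pt g" shows "pp (\<lambda>x. len (f x) \<le> len (g x))"
proof -
  have "ddrop a b = Nil_dat \<longleftrightarrow> len a \<le> len b" for a b
    by (simp add: len_def flip: dl_eq_Nil)
  then show ?thesis using pp_Nil[OF pt_ddrop[OF assms]] by simp
qed

lemma pp_less [intro!]:
  assumes "pt f" "pt g" shows "pp (\<lambda>x. len (f x) < len (g x))"
  using pp_not[OF pp_le[OF assms(2,1)]] by (simp add: not_le)

lemma pp_len_eq [intro!]:
  assumes "pt f" "pt g" shows "pp (\<lambda>x. len (f x) = len (g x))"
  using pp_conj[OF pp_le[OF assms] pp_le[OF assms(2,1)]] by (simp add: eq_iff)

definition dnth :: "dat \<Rightarrow> dat \<Rightarrow> dat" where "dnth l i = dat_hd (ddrop l i)"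

lemma dnth [simp]: "len i < len l \<Longrightarrow> dnth l i = dl l ! len i"
proof -
  have "dat_hd x = dl x ! 0" if "dl x \<noteq> []" for x using that by (cases x) auto
  then show "len i < len l \<Longrightarrow> dnth l i = dl l ! len i"
    by (simp add: dnth_def len_def del: dl_eq_Nil)
qed

lemma pt_dnth [intro!]: "pt L \<Longrightarrow> pt I \<Longrightarrow> pt (\<lambda>x. dnth (L x) (I x))"
  unfolding dnth_def by (intro pt_hd pt_ddrop)

text \<open>Replaces a tree by the canonical numeral that is read as the same number; exact
  encodings can only be built from canonical numerals.\<close>

definition dlen :: "dat \<Rightarrow> dat" where "dlen x = enc_nat (len x)"

lemma len_dlen [simp]: "len (dlen x) = len x"
  by (simp add: dlen_def)

lemma pt_dlen [intro!]: "pt L \<Longrightarrow> pt (\<lambda>x. dlen (L x))"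
proof -
  assume L: "pt L"
  have "dbind l (\<lambda>y. tt) = dlen l" for l
    by (simp add: dlen_def dbind_def tt_def enc_nat_def len_def map_replicate_const[symmetric] concat_map_singleton)
  with pt_dbind[OF L, of "\<lambda>y x. tt"] show ?thesis by auto
qed

text \<open>Descending, because the fold that computes it obtains the next numeral by adding one to
  the head of its accumulator. Later proofs look at the set of entries.\<close>

definition dupt :: "dat \<Rightarrow> dat" where
  "dupt l = enc_list (rev (map enc_nat [0..<len l]))"

lemma dl_dupt [simp]: "dl (dupt l) = rev (map enc_nat [0..<len l])"
  by (simp add: dupt_def)

lemma pt_dupt [intro!]:
  assumes L: "pt L" shows "pt (\<lambda>x. dupt (L x))"
proof -
  let ?F = "\<lambda>a. Pair_dat (if a = Nil_dat then Nil_dat else Pair_dat Nil_dat (dat_hd a)) a"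
  let ?f = "\<lambda>ys. foldl (\<lambda>a y. ?F a) Nil_dat ys"
  have f: "?f ys = enc_list (rev (map enc_nat [0..<length ys]))" for ys :: "dat list"
  proof (induction ys rule: rev_induct)
    case (snoc y ys)
    show ?case by (cases "length ys") (use snoc in auto)
  qed simp
  from L obtain l where l: "poly_bound l" "\<And>x. dat_size (L x) \<le> l (dat_size x)" by (rule pt_size) blast
  let ?B = "\<lambda>n. 1 + l n * (2 * l n + 2)"
  have "pt (\<lambda>x. ?f (dl (L x)))"
  proof (rule pt_fold[where F = "\<lambda>a y x. ?F a", OF L])
    show "poly_bound ?B"
      by (intro poly_bound_add poly_bound_mult poly_bound_const l)
    fix x ys zs assume "dl (L x) = ys @ zs"
    then have ys: "length ys \<le> l (dat_size x)"
      using length_dl_less_dat_size[of "L x"] l(2)[of x] by simp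
    have "(\<Sum>i\<leftarrow>[0..<n]. 1 + dat_size (enc_nat i)) \<le> n * (2 * n + 2)" for n
      by (induction n) (auto simp: dat_size_enc_nat)
    then have "dat_size (?f ys) \<le> 1 + length ys * (2 * length ys + 2)"
      by (simp add: f dat_size_enc_list rev_map[symmetric] comp_def)
    also have "\<dots> \<le> ?B (dat_size x)" using ys by (intro add_mono mult_mono) auto
    finally show "dat_size (?f ys) \<le> ?B (dat_size x)" .
  qed auto
  then show ?thesis by (simp add: f dupt_def len_def)
qed

text \<open>Counterexamples are collected by a comprehension and the resulting list is tested for
  emptiness.\<close>

lemma pp_ball [intro!]:
  assumes "pt L" "pp (\<lambda>z. P (dat_hd z) (dat_tl z))"
  shows "pp (\<lambda>x. \<forall>y \<in> set (dl (L x)). P y x)"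
proof -
  have "dbind l (\<lambda>y. if P y x then Nil_dat else tt) = Nil_dat \<longleftrightarrow> (\<forall>y \<in> set (dl l). P y x)" for l x
    by (auto simp flip: dl_eq_Nil simp: tt_def)
  moreover have "pp (\<lambda>x. dbind (L x) (\<lambda>y. if P y x then Nil_dat else tt) = Nil_dat)"
    using assms by (intro pp_Nil pt_dbind pt_if pt_const)
  ultimately show ?thesis by simp
qed

section \<open>Composition with parameterized reductions\<close>

lemma dl_inject: "dl x = dl y \<longleftrightarrow> x = y"
  by (metis enc_list_dl)

lemma dapp_enc_nat: "dapp (enc_nat m) (enc_nat n) = enc_nat (m + n)"
  by (simp add: dl_inject[symmetric] replicate_add)

lemma dbind_enc_nat: "dbind (enc_nat m) (\<lambda>_. enc_nat n) = enc_nat (m * n)"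
  by (simp add: dl_inject[symmetric]) (induction m; simp add: replicate_add)

lemma poly_bound_power: "poly_bound f \<Longrightarrow> poly_bound (\<lambda>n. f n ^ e)"
  by (induction e) (auto intro: poly_bound_const poly_bound_mult)

text \<open>The parameter factor of a composed reduction contains a polynomial that must be
  \<open>computable\<close> in the formal sense. On unary numerals a sum is an append and a product
  is a comprehension.\<close>

lemma poly_bound_pt:
  "poly_bound h \<Longrightarrow> \<exists>F. pt F \<and> (\<forall>n. F (enc_nat n) = enc_nat (h n))"
proof (induction h rule: poly_bound.induct)
  case poly_bound_id
  then show ?case using pt_id by blast
next
  case (poly_bound_const c)
  have "pt (\<lambda>_. enc_nat c)" by (rule pt_const)
  then show ?case by blast
next
  case (poly_bound_add f g)
  then obtain F G where FG: "pt F" "\<And>n. F (enc_nat n) = enc_nat (f n)" "pt G" "\<And>n. G (enc_nat n) = enc_nat (g n)"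
    by blast
  have "pt (\<lambda>x. dapp (F x) (G x))" using FG by (intro pt_dapp)
  then show ?case using FG by (intro exI[of _ "\<lambda>x. dapp (F x) (G x)"]) (simp add: dapp_enc_nat)
next
  case (poly_bound_mult f g)
  then obtain F G where FG: "pt F" "\<And>n. F (enc_nat n) = enc_nat (f n)" "pt G" "\<And>n. G (enc_nat n) = enc_nat (g n)"
    by blast
  have "pt (\<lambda>x. dbind (F x) (\<lambda>_. G x))"
    by (rule pt_dbind[OF FG(1)], rule pt_comp[OF FG(3), of dat_tl], rule pt_tl, rule pt_id)
  then show ?case using FG by (intro exI[of _ "\<lambda>x. dbind (F x) (\<lambda>_. G x)"]) (simp add: dbind_enc_nat)
qed

section \<open>Fresh variables for arbitrary programs\<close>

fun expr_vars :: "expr \<Rightarrow> nat set" where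
  "expr_vars (Var v) = {v}"
| "expr_vars NilE = {}"
| "expr_vars (ConsE a b) = expr_vars a \<union> expr_vars b"
| "expr_vars (HdE a) = expr_vars a"
| "expr_vars (TlE a) = expr_vars a"

fun com_vars :: "com \<Rightarrow> nat set" where
  "com_vars Skip = {}"
| "com_vars (Assign v e) = insert v (expr_vars e)"
| "com_vars (Seq c d) = com_vars c \<union> com_vars d"
| "com_vars (If e c d) = expr_vars e \<union> com_vars c \<union> com_vars d"
| "com_vars (While e c) = expr_vars e \<union> com_vars c"

lemma finite_com_vars: "finite (com_vars p)"
proof -
  have "finite (expr_vars e)" for e by (induction e) auto
  then show ?thesis by (induction p) auto
qed

lemma expr_val_upd: "v \<notin> expr_vars e \<Longrightarrow> expr_val e (s(v := a)) = expr_val e s"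
  by (induction e) auto

lemma exec_frame:
  "exec p s t s' \<Longrightarrow> v \<notin> com_vars p \<Longrightarrow> exec p (s(v := a)) t (s'(v := a))"
proof (induction rule: exec.induct)
  case (Assign w e s)
  then have "expr_val e (s(v := a)) = expr_val e s" "v \<noteq> w" by (auto intro: expr_val_upd)
  then show ?case using exec.Assign[of w e "s(v := a)"] by (simp only: fun_upd_twist)
qed (auto simp: expr_val_upd intro: exec.intros[simplified])

text \<open>\<open>F\<close> sees \<open>n\<close> together with \<open>f n\<close>, since the new
  parameter factor depends on \<open>k\<close> as well as on the old factor. The program for
  \<open>f\<close> obeys no register discipline, so \<open>n\<close> is saved in a variable that
  does not occur in it. Whatever that program leaves in other registers cannot disturb the program
  for \<open>F\<close>.\<close>

lemma computable_pt:
  assumes "computable f" "pt F" and F: "\<And>n. F (Pair_dat (enc_nat n) (enc_nat (f n))) = enc_nat (g n)"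
  shows "computable g"
proof -
  from \<open>computable f\<close> obtain p where p: "\<And>n. \<exists>t. computes_in p (enc_nat n) t (enc_nat (f n))"
    unfolding computable_def by blast
  from \<open>pt F\<close> obtain h q where q: "pt_on q 0 F h" unfolding pt_def by blast
  obtain v where v: "v \<notin> insert 0 (com_vars p)"
    using finite_com_vars ex_new_if_finite[OF infinite_UNIV_nat] finite_insert by meson
  let ?p = "Seq (Assign v (Var 0)) (Seq p (Seq (Assign 0 (ConsE (Var v) (Var 0))) q))"
  have "\<exists>t. computes_in ?p (enc_nat n) t (enc_nat (g n))" for n
  proof -
    let ?s = "(\<lambda>_. Nil_dat)(0 := enc_nat n)"
    obtain t1 s1 where 1: "exec p ?s t1 s1" "s1 0 = enc_nat (f n)"
      using p[of n] unfolding computes_in_def by blast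
    let ?s1 = "s1(v := enc_nat n)"
    let ?z = "Pair_dat (enc_nat n) (enc_nat (f n))"
    have 0: "exec (Assign v (Var 0)) ?s (1 + dat_size (enc_nat n)) (?s(v := enc_nat n))"
      by (rule exec_Assign') auto
    have 2: "exec p (?s(v := enc_nat n)) t1 ?s1" using exec_frame[OF 1(1)] v by blast
    have 3: "exec (Assign 0 (ConsE (Var v) (Var 0))) ?s1 (1 + dat_size ?z) (?s1(0 := ?z))"
      by (rule exec_Assign') (use v 1 in auto)
    from q obtain t2 s2 where 4: "exec q (?s1(0 := ?z)) t2 s2" "s2 0 = F ?z"
      by (rule pt_onE[where s = "?s1(0 := ?z)"]) simp
    show ?thesis
      unfolding computes_in_def
      using exec.Seq[OF 0 exec.Seq[OF 2 exec.Seq[OF 3 4(1)]]] 4(2) F by auto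
  qed
  then show ?thesis unfolding computable_def by blast
qed

text \<open>A polynomial-time map of the whole pair, with the parameter in unary, is harmless after
  a parameterized reduction: the intermediate instance has size at most a function of
  \<open>k\<close> times a power of the input size, and applying a polynomial keeps this
  form.\<close>

lemma fpt_reducible_pt_trans:
  assumes "A \<le>\<^sub>f\<^sub>p\<^sub>t B" "pt R"
    and R: "\<And>x k. \<exists>x' k'. R (Pair_dat x (enc_nat k)) = Pair_dat x' (enc_nat k') \<and>
      k' \<le> k + d \<and> ((x, k) \<in> B \<longleftrightarrow> (x', k') \<in> C)"
  shows "A \<le>\<^sub>f\<^sub>p\<^sub>t C"
proof -
  from \<open>A \<le>\<^sub>f\<^sub>p\<^sub>t B\<close> obtain p f g c where fg: "computable f" "computable g"
    and p: "\<And>x k. \<exists>x' k' t. computes_in p (Pair_dat x (enc_nat k)) t (Pair_dat x' (enc_nat k')) \<and>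
        t \<le> f k * dat_size x ^ c \<and> k' \<le> g k \<and> ((x, k) \<in> A \<longleftrightarrow> (x', k') \<in> B)"
    unfolding fpt_reducible_def by blast
  from \<open>pt R\<close> obtain h q where h: "poly_bound h" and q: "pt_on q 0 R h" unfolding pt_def by blast
  obtain e where e: "\<And>n. n \<ge> 1 \<Longrightarrow> h n \<le> e * n ^ e" using poly_bound_monomial[OF h] by blast
  \<comment> \<open>The inner coefficient comes from the size of the intermediate instance:
    \<open>2 + 2 * k\<close> for the numeral and its pair node, 1 for \<open>x\<close>, and
    \<open>f k\<close> for the time of \<open>p\<close>, which bounds everything \<open>p\<close>
    writes.\<close>
  define f' where "f' = (\<lambda>k. f k + e * (3 + (k + (k + f k))) ^ e)"
  define g' where "g' = (\<lambda>k. g k + d)"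
  \<comment> \<open>Large enough for both the exponent \<open>c\<close> of the first program and
    \<open>(c + 1) * e\<close> of the second.\<close>
  let ?c = "c + (c + 1) * e"
  have "poly_bound (\<lambda>m. e * (3 + m) ^ e)"
    by (intro poly_bound_mult poly_bound_const poly_bound_power poly_bound_add poly_bound_id)
  then obtain P where P: "pt P" "\<And>n. P (enc_nat n) = enc_nat (e * (3 + n) ^ e)"
    using poly_bound_pt by blast
  have "computable f'"
  proof (rule computable_pt[OF fg(1)])
    show "pt (\<lambda>z. dapp (dat_tl z) (P (dapp (dat_hd z) (dapp (dat_hd z) (dat_tl z)))))"
      by (intro pt_dapp pt_tl pt_id pt_comp[OF P(1)] pt_hd)
  qed (simp add: dapp_enc_nat P f'_def)
  moreover have "computable g'"
    by (rule computable_pt[OF fg(2), of "\<lambda>z. dapp (dat_tl z) (enc_nat d)"])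
      (auto simp: dapp_enc_nat g'_def)
  moreover have "\<exists>x' k' t. computes_in (Seq p q) (Pair_dat x (enc_nat k)) t (Pair_dat x' (enc_nat k')) \<and>
        t \<le> f' k * dat_size x ^ ?c \<and> k' \<le> g' k \<and> ((x, k) \<in> A \<longleftrightarrow> (x', k') \<in> C)" for x k
  proof -
    let ?n = "dat_size x"
    let ?s = "(\<lambda>_. Nil_dat)(0 := Pair_dat x (enc_nat k))"
    have n: "1 \<le> ?n" using dat_size_pos[of x] by linarith
    obtain x1 k1 t1 s1 where 1: "exec p ?s t1 s1" "s1 0 = Pair_dat x1 (enc_nat k1)"
        "t1 \<le> f k * ?n ^ c" "k1 \<le> g k" "(x, k) \<in> A \<longleftrightarrow> (x1, k1) \<in> B"
      using p[of x k] unfolding computes_in_def by blast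
    let ?z = "Pair_dat x1 (enc_nat k1)"
    obtain x2 k2 where 2: "R ?z = Pair_dat x2 (enc_nat k2)" "k2 \<le> k1 + d" "(x1, k1) \<in> B \<longleftrightarrow> (x2, k2) \<in> C"
      using R by blast
    from q obtain t2 s2 where 3: "exec q s1 t2 s2" "t2 \<le> h (dat_size ?z)" "s2 0 = R ?z"
      by (rule pt_onE[where s = s1]) (simp add: 1(2))
    have pow: "?n ^ i \<le> ?n ^ j" if "i \<le> j" for i j using that n by (rule power_increasing)
    have "dat_size ?z \<le> dat_size (Pair_dat x (enc_nat k)) + t1"
      using dat_size_exec[OF 1(1), of 0] 1(2) by simp
    also have "\<dots> = (2 + 2 * k) + ?n + t1" by (simp add: dat_size_enc_nat)
    also have "\<dots> \<le> (2 + 2 * k) * ?n ^ (c + 1) + ?n ^ (c + 1) + f k * ?n ^ (c + 1)"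
    proof (intro add_mono)
      have "1 \<le> ?n ^ (c + 1)" using pow[of 0 "c + 1"] by simp
      from mult_le_mono2[OF this, of "2 + 2 * k"]
      show "2 + 2 * k \<le> (2 + 2 * k) * ?n ^ (c + 1)" by (simp only: mult_1_right)
      show "?n \<le> ?n ^ (c + 1)" using pow[of 1 "c + 1"] by simp
      show "t1 \<le> f k * ?n ^ (c + 1)" by (rule order_trans[OF 1(3) mult_le_mono2[OF pow]]) simp
    qed
    also have "\<dots> = (3 + (k + (k + f k))) * ?n ^ (c + 1)" by (simp add: algebra_simps)
    finally have z: "dat_size ?z \<le> (3 + (k + (k + f k))) * ?n ^ (c + 1)" .
    have "t2 \<le> e * dat_size ?z ^ e" by (rule order_trans[OF 3(2) e]) simp
    also have "\<dots> \<le> e * ((3 + (k + (k + f k))) * ?n ^ (c + 1)) ^ e"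
      by (rule mult_left_mono[OF power_mono[OF z]]) simp_all
    also have "\<dots> = e * (3 + (k + (k + f k))) ^ e * ?n ^ ((c + 1) * e)"
      by (subst power_mult_distrib, subst power_mult, rule mult.assoc[symmetric])
    also have "\<dots> \<le> e * (3 + (k + (k + f k))) ^ e * ?n ^ ?c"
      by (rule mult_left_mono[OF pow]) simp_all
    finally have t2: "t2 \<le> e * (3 + (k + (k + f k))) ^ e * ?n ^ ?c" .
    have "t1 \<le> f k * ?n ^ ?c" by (rule order_trans[OF 1(3) mult_le_mono2[OF pow]]) simp
    with t2 have "t1 + t2 \<le> f' k * ?n ^ ?c" unfolding f'_def add_mult_distrib by linarith
    moreover have "computes_in (Seq p q) (Pair_dat x (enc_nat k)) (t1 + t2) (Pair_dat x2 (enc_nat k2))"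
      unfolding computes_in_def using exec.Seq[OF 1(1) 3(1)] 3(3) 2(1) by auto
    moreover have "k2 \<le> g' k" using 2(2) 1(4) by (simp add: g'_def)
    ultimately show ?thesis using 1(5) 2(3) by blast
  qed
  ultimately show ?thesis unfolding fpt_reducible_def by blast
qed

section \<open>The digraph of a family of forbidden sets\<close>

text \<open>Elements are the vertices below \<open>m\<close>; block \<open>q\<close> of \<open>L\<close> further vertices is the path of the root
  for \<open>q = 0\<close>, and of the forbidden set number \<open>q - 1\<close> otherwise.\<close>

definition gadget_size :: "nat \<Rightarrow> nat list list \<Rightarrow> nat \<Rightarrow> nat" where
  "gadget_size m H L = m + Suc (length H) * L"

text \<open>The root path is closed into a cycle by the arc from its last vertex to
  \<open>m\<close>, and the elements hang on this cycle. The block of a forbidden set is entered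
  only from the elements of the set and left only towards \<open>m\<close>.\<close>

definition gadget_arcs :: "nat \<Rightarrow> nat list list \<Rightarrow> nat \<Rightarrow> (nat \<times> nat) set" where
  "gadget_arcs m H L =
    {(m + (L - 1), m)} \<union>
    {(m + q * L + j, m + q * L + Suc j) | q j. q < Suc (length H) \<and> j < L - 1} \<union>
    {(m + (L - 1), v) | v. v < m} \<union> {(v, m) | v. v < m} \<union>
    {(m + Suc h * L + (L - 1), m) | h. h < length H} \<union>
    {(v, m + Suc h * L) | v h. h < length H \<and> v \<in> set (H ! h)}"

lemma block_decomposition_unique:
  fixes L :: nat
  assumes "q * L + j = q' * L + j'" "j < L" "j' < L"
  shows "q = q' \<and> j = j'"
proof -
  have "(q * L + j) div L = q" "(q * L + j) mod L = j" using assms(2) by auto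
  moreover have "(q' * L + j') div L = q'" "(q' * L + j') mod L = j'" using assms(3) by auto
  ultimately show ?thesis using assms by metis
qed

text \<open>A discrete intermediate value principle. It finds the border between deleted and
  surviving vertices of a path, and later the gap of an enumeration into which a gate falls.\<close>

lemma adjacent_change:
  assumes "P i" "\<not> P j" "i < L" "j < (L :: nat)"
  shows "\<exists>l. Suc l < L \<and> P l \<noteq> P (Suc l)"
proof (rule ccontr)
  assume *: "\<not> ?thesis"
  have "P l = P 0" if "l < L" for l
    using that by (induction l) (metis, metis * Suc_lessD)
  with assms show False by metis
qed

locale gadget =
  fixes m L :: nat and H :: "nat list list" and es :: "(nat \<times> nat) list"
  \<comment> \<open>Two vertices per block keep its first and last vertex apart, so the arc closing
    the root path is not a loop.\<close>
  assumes es: "set es = gadget_arcs m H L" and L: "2 \<le> L"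
    and H: "\<And>h. h \<in> set H \<Longrightarrow> set h \<subseteq> {..<m}"
begin

abbreviation "n \<equiv> gadget_size m H L"
abbreviation "p q j \<equiv> m + q * L + j"

lemma p_less: "q \<le> length H \<Longrightarrow> j < L \<Longrightarrow> p q j < n"
proof -
  assume "q \<le> length H" "j < L"
  then have "q * L + j < q * L + L" "q * L \<le> length H * L" by (auto intro: mult_le_mono1)
  then show ?thesis unfolding gadget_size_def mult_Suc by linarith
qed

lemma p_inj: "p q j = p q' j' \<Longrightarrow> j < L \<Longrightarrow> j' < L \<Longrightarrow> q = q' \<and> j = j'"
  by (rule block_decomposition_unique) auto

lemma vertex_cases:
  assumes "x < n"
  obtains "x < m" | q j where "x = p q j" "q \<le> length H" "j < L"
proof (cases "x < m")
  case False
  have "x = p ((x - m) div L) ((x - m) mod L)" using False by simp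
  moreover have "x - m < Suc (length H) * L" using assms False by (simp add: gadget_size_def)
  then have "(x - m) div L < Suc (length H)" using L by (metis less_mult_imp_div_less)
  moreover have "(x - m) mod L < L" using L by simp
  ultimately show ?thesis using that(2) less_Suc_eq_le by blast
qed (use that in blast)

text \<open>Makes deletion spread forwards along a block: a vertex that loses its only in-neighbour
  can no longer be reached. Dually, \<open>out_arc\<close> makes it spread backwards.\<close>

lemma in_arc:
  assumes "(x, p q (Suc j)) \<in> set es" "Suc j < L" shows "x = p q j"
proof -
  have 1: "p q (Suc j) \<noteq> p q' 0" for q' using p_inj[of q "Suc j" q' 0] assms(2) by auto
  have 2: "q = q' \<and> j = j'" if "p q (Suc j) = p q' (Suc j')" "j' < L - 1" for q' j'
    using p_inj[OF that(1)] that(2) assms(2) by auto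
  from 1[of 0] 1 have "p q (Suc j) \<noteq> m" "\<And>h. p q (Suc j) \<noteq> m + Suc h * L" "\<not> p q (Suc j) < m"
    by (metis add.right_neutral mult_zero_left, metis add.right_neutral, simp)
  with assms(1) 2 show ?thesis unfolding es gadget_arcs_def by blast
qed

lemma out_arc:
  assumes "(p q j, x) \<in> set es" "Suc j < L" shows "x = p q (Suc j)"
proof -
  have 1: "p q j \<noteq> p q' (L - 1)" for q' using p_inj[of q j q' "L - 1"] assms(2) by auto
  have 2: "q = q' \<and> j = j'" if "p q j = p q' j'" "j' < L - 1" for q' j'
    using p_inj[OF that(1)] that(2) assms(2) by auto
  have 3: "v < m" if "h < length H" "v \<in> set (H ! h)" for v h using H that by (meson lessThan_iff nth_mem subsetD)
  from 1[of 0] 1 have "p q j \<noteq> m + (L - 1)" "\<And>h. p q j \<noteq> m + Suc h * L + (L - 1)" "\<not> p q j < m"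
    by (metis add.right_neutral mult_zero_left, metis, simp)
  with assms(1) 2 3 show ?thesis unfolding es gadget_arcs_def by blast
qed

lemma edge_arc:
  assumes "(x, p (Suc h) 0) \<in> set es" "h < length H" shows "x \<in> set (H ! h)"
proof -
  have 1: "p (Suc h) 0 \<noteq> p q (Suc j)" if "j < L - 1" for q j
  proof
    assume "p (Suc h) 0 = p q (Suc j)"
    moreover have "0 < L" "Suc j < L" using that L by auto
    ultimately show False using p_inj by blast
  qed
  have 2: "h = h'" if "m + Suc h * L = m + Suc h' * L" for h' using that L by auto
  have "p (Suc h) 0 \<noteq> m" "\<not> p (Suc h) 0 < m" using L by auto
  with assms(1) 1 2 show ?thesis unfolding es gadget_arcs_def by auto
qed

lemma arc_bounds:
  assumes "(x, y) \<in> set es" shows "x < n \<and> y < n \<and> x \<noteq> y"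
proof -
  have 1: "m + (L - 1) < n" "m < n" using p_less[of 0 "L - 1"] p_less[of 0 0] L by auto
  have 2: "p q j < n" "p q (Suc j) < n" if "q < Suc (length H)" "j < L - 1" for q j
    using p_less[of q j] p_less[of q "Suc j"] that by auto
  have 3: "v < m" if "h < length H" "v \<in> set (H ! h)" for v h using H that by (meson lessThan_iff nth_mem subsetD)
  have 4: "m + Suc h * L + (L - 1) < n" "m + Suc h * L < n" if "h < length H" for h
    using p_less[of "Suc h" "L - 1"] p_less[of "Suc h" 0] that L by auto
  from assms consider "x = m + (L - 1)" "y = m" | q j where "q < Suc (length H)" "j < L - 1" "x = p q j" "y = p q (Suc j)"
    | "x = m + (L - 1)" "y < m" | "x < m" "y = m" | h where "h < length H" "x = m + Suc h * L + (L - 1)" "y = m"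
    | h where "h < length H" "x \<in> set (H ! h)" "y = m + Suc h * L"
    unfolding es gadget_arcs_def by blast
  then show ?thesis
  proof cases
    case 6
    then have "x < m" using 3 by blast
    moreover have "y < n" using 6 4 by blast
    ultimately show ?thesis using 6 1 by linarith
  qed (use 1 2 4 L in auto)
qed

lemma digraph_gadget: "digraph (list_digraph n es)"
proof -
  have "fst e < n" "snd e < n" "fst e \<noteq> snd e" if "e \<in> set es" for e
    using arc_bounds[of "fst e" "snd e"] that by auto
  then have "wf_digraph (list_digraph n es)" "fin_digraph_axioms (list_digraph n es)"
      "loopfree_digraph_axioms (list_digraph n es)"
    unfolding wf_digraph_def fin_digraph_axioms_def loopfree_digraph_axioms_def
    by (simp_all add: list_digraph_def)
  moreover have "nomulti_digraph_axioms (list_digraph n es)"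
    unfolding nomulti_digraph_axioms_def by (simp add: list_digraph_def arc_to_ends_def prod_eq_iff)
  ultimately show ?thesis
    by (intro digraph.intro fin_digraph.intro loopfree_digraph.intro nomulti_digraph.intro)
qed

text \<open>The slack \<open>+ 2\<close> has two uses: a block is longer than \<open>S\<close> is
  large, so it cannot be deleted entirely, and at least two vertices survive, so every survivor has
  a surviving in-neighbour and out-neighbour.\<close>

lemma preserves_iff:
  assumes S: "S \<subseteq> {0..<n}" and card: "card S + 2 \<le> L"
  shows "preserves_strong_connectivity (list_digraph n es) S \<longleftrightarrow>
    S \<subseteq> {..<m} \<and> (\<forall>h \<in> set H. \<not> set h \<subseteq> S)"
proof -
  define V where "V = {0..<n} - S"
  define D where "D = list_digraph n es \<restriction> V"
  have D: "verts D = V" "\<And>x y. (x, y) \<in> arcs_ends D \<longleftrightarrow> (x, y) \<in> set es \<and> x \<in> V \<and> y \<in> V"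
    by (auto simp: D_def list_digraph_def arcs_ends_conv image_iff)
  have fin: "finite S" using S finite_subset by blast
  have goal: "preserves_strong_connectivity (list_digraph n es) S \<longleftrightarrow> strongly_connected D"
    by (simp add: preserves_strong_connectivity_def D_def V_def list_digraph_def)
  have arc_reachable: "x \<rightarrow>\<^sup>*\<^bsub>D\<^esub> y" if "(x, y) \<in> set es" "x \<in> V" "y \<in> V" for x y
    unfolding reachable_def using that by (metis D rtrancl_on_refl rtrancl_on_into_rtrancl_on)
  have trans: "x \<rightarrow>\<^sup>*\<^bsub>D\<^esub> z" if "x \<rightarrow>\<^sup>*\<^bsub>D\<^esub> y" "y \<rightarrow>\<^sup>*\<^bsub>D\<^esub> z" for x y z
    using that unfolding reachable_def by (rule rtrancl_on_trans)
  have "card V \<ge> 2"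
  proof -
    have "card V = n - card S" unfolding V_def using S fin by (simp add: card_Diff_subset)
    moreover have "n \<ge> L" by (simp add: gadget_size_def)
    ultimately show ?thesis using card by linarith
  qed
  have other: "\<exists>z \<in> V. z \<noteq> x" for x
  proof (rule ccontr)
    assume "\<not> (\<exists>z \<in> V. z \<noteq> x)"
    then have "V \<subseteq> {x}" by blast
    then have "card V \<le> card {x}" by (intro card_mono) auto
    with \<open>card V \<ge> 2\<close> show False by simp
  qed
  show ?thesis
    unfolding goal
  proof
    assume sc: "strongly_connected D"
    then have R: "x \<rightarrow>\<^sup>*\<^bsub>D\<^esub> y" if "x \<in> V" "y \<in> V" for x y
      using that by (auto simp: strongly_connected_def D)
    have ins: "\<exists>y \<in> V. (y, x) \<in> set es" if "x \<in> V" for x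
    proof -
      obtain z where z: "z \<in> V" "z \<noteq> x" using other by blast
      from R[OF z(1) that] have "(z, x) \<in> rtrancl_on V (arcs_ends D)" by (simp add: reachable_def D)
      then show ?thesis by cases (use z D in auto)
    qed
    have outs: "\<exists>y \<in> V. (x, y) \<in> set es" if "x \<in> V" for x
    proof -
      obtain z where z: "z \<in> V" "z \<noteq> x" using other by blast
      from R[OF that z(1)] have "(x, z) \<in> rtrancl_on V (arcs_ends D)" by (simp add: reachable_def D)
      then show ?thesis by (cases rule: converse_rtrancl_on_cases) (use z D in auto)
    qed
    \<comment> \<open>A partly deleted block contains a border. If the earlier vertex of the border
      is deleted, the later one has lost its only in-neighbour; otherwise the earlier one has lost
      its only out-neighbour.\<close>
    have paths: "p q j \<in> V" if qj: "q \<le> length H" "j < L" for q j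
    proof (rule ccontr)
      assume "p q j \<notin> V"
      then have "p q j \<in> S" using p_less[OF qj] by (simp add: V_def)
      have "\<not> p q ` {..<L} \<subseteq> S"
      proof
        assume "p q ` {..<L} \<subseteq> S"
        then have "card (p q ` {..<L}) \<le> card S" using fin card_mono by blast
        moreover have "card (p q ` {..<L}) = L" by (subst card_image) (auto intro: inj_onI)
        ultimately show False using card by linarith
      qed
      then obtain i where i: "i < L" "p q i \<notin> S" by auto
      obtain l where l: "Suc l < L" "(p q l \<in> S) \<noteq> (p q (Suc l) \<in> S)"
        using adjacent_change[of "\<lambda>l. p q l \<in> S", OF \<open>p q j \<in> S\<close> i(2) qj(2) i(1)] by blast
      then have "l < L" by simp
      then have less: "p q l < n" "p q (Suc l) < n" using p_less[OF qj(1)] l(1) by blast+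
      show False
      proof (cases "p q l \<in> S")
        case True
        with l less have "p q (Suc l) \<in> V" by (simp add: V_def)
        then obtain y where "y \<in> V" "(y, p q (Suc l)) \<in> set es" using ins by blast
        with in_arc[OF _ l(1)] True show False by (auto simp: V_def)
      next
        case False
        with l less have "p q l \<in> V" by (simp add: V_def)
        then obtain y where "y \<in> V" "(p q l, y) \<in> set es" using outs by blast
        with out_arc[OF _ l(1)] False l show False by (auto simp: V_def)
      qed
    qed
    have "S \<subseteq> {..<m}"
    proof
      fix x assume "x \<in> S"
      with S have "x < n" by auto
      then show "x \<in> {..<m}"
        by (cases x rule: vertex_cases) (use paths \<open>x \<in> S\<close> in \<open>auto simp: V_def\<close>)
    qed
    moreover have "\<not> set (H ! h) \<subseteq> S" if "h < length H" for h
    proof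
      assume *: "set (H ! h) \<subseteq> S"
      have "p (Suc h) 0 \<in> V" using paths[of "Suc h" 0] that L by simp
      then obtain y where "y \<in> V" "(y, p (Suc h) 0) \<in> set es" using ins by blast
      with edge_arc[OF _ that] * show False by (auto simp: V_def)
    qed
    ultimately show "S \<subseteq> {..<m} \<and> (\<forall>h \<in> set H. \<not> set h \<subseteq> S)" by (auto simp: set_conv_nth)
  next
    assume "S \<subseteq> {..<m} \<and> (\<forall>h \<in> set H. \<not> set h \<subseteq> S)"
    then have Sm: "S \<subseteq> {..<m}" and SH: "\<And>h. h < length H \<Longrightarrow> \<not> set (H ! h) \<subseteq> S" by auto
    have paths: "p q j \<in> V" if "q \<le> length H" "j < L" for q j
      using p_less[OF that] Sm by (auto simp: V_def)
    have mV: "m \<in> V" and m'V: "m + (L - 1) \<in> V" using paths[of 0 0] paths[of 0 "L - 1"] L by auto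
    have along: "(p q i) \<rightarrow>\<^sup>*\<^bsub>D\<^esub> (p q j)" if "q \<le> length H" "i \<le> j" "j < L" for q i j
      using that(2,3)
    proof (induction j rule: dec_induct)
      case base
      then show ?case using paths[OF that(1)] that by (auto simp: reachable_def D)
    next
      case (step j)
      have "q < Suc (length H) \<and> j < L - 1" using that(1) step by simp
      then have "(p q j, p q (Suc j)) \<in> set es" unfolding es gadget_arcs_def by blast
      then have "(p q j) \<rightarrow>\<^sup>*\<^bsub>D\<^esub> (p q (Suc j))" using paths[OF that(1)] step.prems by (intro arc_reachable) (blast intro: Suc_lessD)+
      then show ?case using step trans by (meson Suc_lessD)
    qed
    have root: "m \<rightarrow>\<^sup>*\<^bsub>D\<^esub> (m + (L - 1))" using along[of 0 0 "L - 1"] L by simp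
    have elem: "m \<rightarrow>\<^sup>*\<^bsub>D\<^esub> v" "v \<rightarrow>\<^sup>*\<^bsub>D\<^esub> m" if "v < m" "v \<in> V" for v
    proof -
      have "(m + (L - 1), v) \<in> set es" "(v, m) \<in> set es" unfolding es gadget_arcs_def using that by auto
      then show "m \<rightarrow>\<^sup>*\<^bsub>D\<^esub> v" "v \<rightarrow>\<^sup>*\<^bsub>D\<^esub> m" using arc_reachable trans[OF root] that mV m'V by blast+
    qed
    \<comment> \<open>The root vertex \<open>m\<close> is the hub; the block of a forbidden set is
      reached from it through an element of the set that survives.\<close>
    have both: "m \<rightarrow>\<^sup>*\<^bsub>D\<^esub> x \<and> x \<rightarrow>\<^sup>*\<^bsub>D\<^esub> m" if "x \<in> V" for x
    proof -
      have "x < n" using that by (simp add: V_def)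
      then show ?thesis
      proof (cases x rule: vertex_cases)
        case 1
        then show ?thesis using elem that by blast
      next
        case (2 q j)
        have a1: "x \<rightarrow>\<^sup>*\<^bsub>D\<^esub> (p q (L - 1))" using along[of q j "L - 1"] 2 by auto
        have a2: "(p q 0) \<rightarrow>\<^sup>*\<^bsub>D\<^esub> x" using along[of q 0 j] 2 by auto
        have pV: "p q (L - 1) \<in> V" "p q 0 \<in> V" by (rule paths[OF 2(2)]; use L in simp)+
        show ?thesis
        proof (cases q)
          case 0
          have "(m + (L - 1), m) \<in> set es" unfolding es gadget_arcs_def by blast
          then have "(m + (L - 1)) \<rightarrow>\<^sup>*\<^bsub>D\<^esub> m" using arc_reachable m'V mV by blast
          moreover have "x \<rightarrow>\<^sup>*\<^bsub>D\<^esub> (m + (L - 1))" "m \<rightarrow>\<^sup>*\<^bsub>D\<^esub> x" using a1 a2 0 by simp_all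
          ultimately show ?thesis using trans by blast
        next
          case (Suc h)
          then have h: "h < length H" using 2 by simp
          have "(p q (L - 1), m) \<in> set es" unfolding es gadget_arcs_def Suc using h by blast
          then have "x \<rightarrow>\<^sup>*\<^bsub>D\<^esub> m" using arc_reachable pV mV a1 trans by blast
          moreover obtain v where v: "v \<in> set (H ! h)" "v \<notin> S" using SH h by blast
          then have "v < m" using H h by (meson lessThan_iff nth_mem subsetD)
          then have "v \<in> V" using v(2) mV by (auto simp: V_def)
          have "(v, p q 0) \<in> set es" unfolding es gadget_arcs_def Suc using h v(1) by auto
          then have "v \<rightarrow>\<^sup>*\<^bsub>D\<^esub> (p q 0)" using arc_reachable pV \<open>v \<in> V\<close> by blast
          with elem(1)[OF \<open>v < m\<close> \<open>v \<in> V\<close>] a2 have "m \<rightarrow>\<^sup>*\<^bsub>D\<^esub> x" using trans by blast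
          ultimately show ?thesis by blast
        qed
      qed
    qed
    then show "strongly_connected D" unfolding strongly_connected_def D using mV trans by blast
  qed
qed

text \<open>\<open>VDPSC\<close> also demands a strongly connected input, which is the case of
  deleting nothing. It fails only if the empty set is forbidden, and then no \<open>S\<close> avoids
  all forbidden sets either, so the final equivalence is unaffected.\<close>

lemma strongly_connected_iff:
  "strongly_connected (list_digraph n es) \<longleftrightarrow> [] \<notin> set H"
proof -
  have "list_digraph n es \<restriction> (verts (list_digraph n es) - {}) = list_digraph n es"
    using arc_bounds[of "fst e" "snd e" for e] by (auto simp: list_digraph_def induce_subgraph_def)
  then show ?thesis
    using preserves_iff[of "{}"] L by (auto simp: preserves_strong_connectivity_def)
qed

theorem enc_digraph_in_VDPSC_iff:
  assumes "k + 2 \<le> L"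
  shows "(enc_digraph n es, k) \<in> VDPSC \<longleftrightarrow>
    (\<exists>S \<subseteq> {..<m}. card S = k \<and> (\<forall>h \<in> set H. \<not> set h \<subseteq> S))"
proof -
  have "(enc_digraph n es, k) \<in> VDPSC \<longleftrightarrow> [] \<notin> set H \<and>
    (\<exists>S \<subseteq> {0..<n}. card S = k \<and> preserves_strong_connectivity (list_digraph n es) S)"
    using digraph_gadget strongly_connected_iff
    by (auto simp: VDPSC_def inj_enc_digraph list_digraph_def)
  also have "\<dots> \<longleftrightarrow> (\<exists>S \<subseteq> {..<m}. card S = k \<and> (\<forall>h \<in> set H. \<not> set h \<subseteq> S))"
    (is "?l \<longleftrightarrow> ?r")
  proof
    assume ?l
    then obtain S where "S \<subseteq> {0..<n}" "card S = k" "preserves_strong_connectivity (list_digraph n es) S" by blast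
    then show ?r using preserves_iff[of S] assms by auto
  next
    assume ?r
    then obtain S where S: "S \<subseteq> {..<m}" "card S = k" "\<forall>h \<in> set H. \<not> set h \<subseteq> S" by blast
    have "S \<subseteq> {0..<n}" using S(1) by (force simp: gadget_size_def)
    moreover have "[] \<notin> set H" using S(3) by force
    ultimately show ?l using preserves_iff[of S] assms S by blast
  qed
  finally show ?thesis .
qed

end

section \<open>Circuits\<close>

definition gate_vals :: "nat set \<Rightarrow> circuit \<Rightarrow> bool list" where
  "gate_vals T C = foldl (\<lambda>vs g. vs @ [gate_val T vs g]) [] C"

lemma gate_vals_snoc: "gate_vals T (C @ [g]) = gate_vals T C @ [gate_val T (gate_vals T C) g]"
  by (simp add: gate_vals_def)

lemma length_gate_vals [simp]: "length (gate_vals T C) = length C"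
  by (induction C rule: rev_induct) (simp_all add: gate_vals_snoc, simp add: gate_vals_def)

lemma nth_gate_vals:
  "i < length C \<Longrightarrow> gate_vals T C ! i = gate_val T (take i (gate_vals T C)) (C ! i)"
  by (induction C rule: rev_induct) (auto simp: gate_vals_snoc nth_append less_Suc_eq)

lemma satisfies_iff: "C \<noteq> [] \<Longrightarrow> satisfies T C \<longleftrightarrow> gate_vals T C ! (length C - 1)"
  by (metis gate_vals_def last_conv_nth length_0_conv length_gate_vals satisfies_def)

lemma wf_circuitD:
  assumes "wf_circuit C" "i < length C"
  shows "proper_gate (C ! i)" "j \<in> set (preds (C ! i)) \<Longrightarrow> j < i"
  using assms by (auto simp: wf_circuit_def)

text \<open>In topological order all predecessors lie in the prefix, so the full list of values can
  replace it.\<close>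

lemma gate_vals_rec:
  assumes "wf_circuit C" "i < length C"
  shows "C ! i = Input_gate \<Longrightarrow> gate_vals T C ! i \<longleftrightarrow> i \<in> T"
    "C ! i = Not_gate j \<Longrightarrow> gate_vals T C ! i \<longleftrightarrow> \<not> gate_vals T C ! j"
    "C ! i = And_gate js \<Longrightarrow> gate_vals T C ! i \<longleftrightarrow> (\<forall>j \<in> set js. gate_vals T C ! j)"
    "C ! i = Or_gate js \<Longrightarrow> gate_vals T C ! i \<longleftrightarrow> (\<exists>j \<in> set js. gate_vals T C ! j)"
  using assms nth_gate_vals[OF assms(2), of T] wf_circuitD(2)[OF assms] by auto


section \<open>Depth and weft by recursion from the output\<close>

text \<open>Weft and depth quantify over all paths, of which a circuit may have exponentially many.
  These recursions of fixed depth express the same bounds and are easy to decide. Seen from the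
  output, everything below the first gate of large fan-in must be \<open>small_ok\<close>.\<close>

fun small_ok :: "nat \<Rightarrow> circuit \<Rightarrow> nat \<Rightarrow> bool" where
  "small_ok 0 C i \<longleftrightarrow> preds (C ! i) = []"
| "small_ok (Suc d) C i \<longleftrightarrow> length (preds (C ! i)) \<le> 2 \<and> (\<forall>j \<in> set (preds (C ! i)). small_ok d C j)"

fun weft_ok :: "nat \<Rightarrow> circuit \<Rightarrow> nat \<Rightarrow> bool" where
  "weft_ok 0 C i \<longleftrightarrow> preds (C ! i) = []"
| "weft_ok (Suc d) C i \<longleftrightarrow>
    (if length (preds (C ! i)) \<le> 2 then \<forall>j \<in> set (preds (C ! i)). weft_ok d C j
     else \<forall>j \<in> set (preds (C ! i)). small_ok d C j)"

lemma small_ok_imp_weft_ok: "small_ok d C i \<Longrightarrow> weft_ok d C i"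
  by (induction d arbitrary: i) auto

definition paths_to :: "circuit \<Rightarrow> nat \<Rightarrow> nat list set" where
  "paths_to C i = {p. p \<noteq> [] \<and> set p \<subseteq> {..<length C} \<and> hd p \<in> inputs C \<and> last p = i \<and>
    successively (\<lambda>i j. i \<in> set (preds (C ! j))) p}"

definition large_gates :: "circuit \<Rightarrow> nat list \<Rightarrow> nat" where
  "large_gates C p = length (filter (\<lambda>i. length (preds (C ! i)) > 2) p)"

text \<open>Proper conjunctions and disjunctions have fan-in at least 2, so there are no constant
  gates.\<close>

lemma input_iff: "wf_circuit C \<Longrightarrow> i < length C \<Longrightarrow> i \<in> inputs C \<longleftrightarrow> preds (C ! i) = []"
  using wf_circuitD(1)[of C i] by (cases "C ! i") (auto simp: inputs_def)

lemma paths_to_eq: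
  assumes "wf_circuit C" "i < length C"
  shows "paths_to C i = (if preds (C ! i) = [] then {[i]} else (\<Union>j \<in> set (preds (C ! i)). (\<lambda>p. p @ [i]) ` paths_to C j))"
    (is "_ = ?r")
proof (intro equalityI subsetI)
  fix p assume p: "p \<in> paths_to C i"
  then obtain q where q: "p = q @ [i]"
    by (auto simp: paths_to_def) (metis append_butlast_last_id)
  show "p \<in> ?r"
  proof (cases "q = []")
    case True
    then show ?thesis using p q input_iff[OF assms] by (auto simp: paths_to_def)
  next
    case False
    then have "q \<in> paths_to C (last q)" "last q \<in> set (preds (C ! i))"
      using p q by (auto simp: paths_to_def successively_append_iff)
    then show ?thesis using q by auto
  qed
next
  fix p assume p: "p \<in> ?r"
  show "p \<in> paths_to C i"
  proof (cases "preds (C ! i) = []")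
    case True
    then show ?thesis using p input_iff[OF assms] assms by (auto simp: paths_to_def)
  next
    case False
    then obtain j q where "j \<in> set (preds (C ! i))" "q \<in> paths_to C j" "p = q @ [i]" using p by auto
    then show ?thesis using assms by (auto simp: paths_to_def successively_append_iff)
  qed
qed

text \<open>A gate of large fan-in is counted only by paths through it, so a violation is visible
  only if some path from an input reaches the gate.\<close>

lemma paths_to_nonempty:
  assumes "wf_circuit C" "i < length C" shows "paths_to C i \<noteq> {}"
  using assms(2)
proof (induction i rule: less_induct)
  case (less i)
  show ?case
  proof (cases "preds (C ! i) = []")
    case False
    then obtain j where j: "j \<in> set (preds (C ! i))" using last_in_set by blast
    then have "j < i" using wf_circuitD(2)[OF assms(1) less.prems] by blast
    then have "paths_to C j \<noteq> {}" using less by simp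
    then show ?thesis using False j by (auto simp: paths_to_eq[OF assms(1) less.prems])
  qed (simp add: paths_to_eq[OF assms(1) less.prems])
qed

text \<open>The weft bound \<open>w\<close> is left open so that one base case serves both
  recursions.\<close>

lemma ok_0_iff:
  assumes "wf_circuit C" "i < length C"
  shows "preds (C ! i) = [] \<longleftrightarrow> (\<forall>p \<in> paths_to C i. length p - 1 \<le> 0 \<and> large_gates C p \<le> w)"
proof (cases "preds (C ! i) = []")
  case True
  then show ?thesis by (simp add: paths_to_eq[OF assms] large_gates_def)
next
  case False
  then obtain j where j: "j \<in> set (preds (C ! i))" using last_in_set by blast
  then have "j < length C" using wf_circuitD(2)[OF assms] assms(2) by (meson less_trans)
  then obtain q where q: "q \<in> paths_to C j" using paths_to_nonempty[OF assms(1)] by blast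
  then have "q @ [i] \<in> paths_to C i" "q \<noteq> []" using False j by (auto simp: paths_to_eq[OF assms], auto simp: paths_to_def)
  moreover from this have "\<not> length (q @ [i]) - 1 \<le> 0" by simp
  ultimately show ?thesis using False by blast
qed

lemma paths_to_Suc:
  assumes "wf_circuit C" "i < length C" "preds (C ! i) \<noteq> []"
  shows "(\<forall>p \<in> paths_to C i. length p - 1 \<le> Suc d \<and> large_gates C p \<le> w) \<longleftrightarrow>
    (\<forall>j \<in> set (preds (C ! i)). \<forall>p \<in> paths_to C j. length p - 1 \<le> d \<and>
      large_gates C p + (if length (preds (C ! i)) > 2 then 1 else 0) \<le> w)"
proof -
  have "length p - 1 \<le> d \<longleftrightarrow> length p \<le> Suc d" for p :: "nat list" by (cases p) auto
  then show ?thesis using assms(3) by (auto simp: paths_to_eq[OF assms(1,2)] large_gates_def)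
qed

lemma small_ok_iff:
  "wf_circuit C \<Longrightarrow> i < length C \<Longrightarrow>
    small_ok d C i \<longleftrightarrow> (\<forall>p \<in> paths_to C i. length p - 1 \<le> d \<and> large_gates C p \<le> 0)"
proof (induction d arbitrary: i)
  case 0
  then show ?case using ok_0_iff[of C i 0] by simp
next
  case (Suc d)
  have j: "j < length C" if "j \<in> set (preds (C ! i))" for j
    using wf_circuitD(2)[OF Suc.prems that] Suc.prems(2) by simp
  show ?case
  proof (cases "preds (C ! i) = []")
    case True
    then show ?thesis by (simp add: paths_to_eq[OF Suc.prems] large_gates_def)
  next
    case False
    then obtain k where k: "k \<in> set (preds (C ! i))" using last_in_set by blast
    with j paths_to_nonempty[OF Suc.prems(1)] obtain q where "q \<in> paths_to C k" by blast
    then show ?thesis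
      using k Suc.IH[OF Suc.prems(1) j]
      unfolding paths_to_Suc[OF Suc.prems False] by (auto simp: not_le)
  qed
qed

text \<open>A large gate uses up the allowance of one, so for the paths below it the bound 1 becomes
  0, the bound that \<open>small_ok\<close> expresses.\<close>

lemma weft_ok_iff:
  "wf_circuit C \<Longrightarrow> i < length C \<Longrightarrow>
    weft_ok d C i \<longleftrightarrow> (\<forall>p \<in> paths_to C i. length p - 1 \<le> d \<and> large_gates C p \<le> 1)"
proof (induction d arbitrary: i)
  case 0
  then show ?case using ok_0_iff[of C i 1] by simp
next
  case (Suc d)
  have j: "j < length C" if "j \<in> set (preds (C ! i))" for j
    using wf_circuitD(2)[OF Suc.prems that] Suc.prems(2) by simp
  show ?case
  proof (cases "preds (C ! i) = []")
    case True
    then show ?thesis by (simp add: paths_to_eq[OF Suc.prems] large_gates_def)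
  next
    case False
    then show ?thesis
      using Suc.IH[OF Suc.prems(1) j] small_ok_iff[OF Suc.prems(1) j]
      unfolding paths_to_Suc[OF Suc.prems False] by (auto simp: not_le)
  qed
qed

lemma weft_depth_iff:
  assumes "wf_circuit C"
  shows "weft_at_most 1 C \<and> depth_at_most d C \<longleftrightarrow> weft_ok d C (length C - 1)"
proof -
  have "circuit_path C p \<longleftrightarrow> p \<in> paths_to C (length C - 1)" for p
    by (auto simp: circuit_path_def paths_to_def)
  then show ?thesis
    using weft_ok_iff[OF assms, of "length C - 1" d] assms
    by (auto simp: weft_at_most_def depth_at_most_def large_gates_def wf_circuit_def)
qed

section \<open>Deciding weft and depth on encoded circuits\<close>

lemma pp_le_const [intro!]: "pt f \<Longrightarrow> pp (\<lambda>x. len (f x) \<le> c)"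
  using pp_le[OF _ pt_const[of "enc_nat c"]] by simp

lemma pp_len_eq_const [intro!]: "pt f \<Longrightarrow> pp (\<lambda>x. len (f x) = c)"
  using pp_len_eq[OF _ pt_const[of "enc_nat c"]] by simp

lemmas pt_intros = pt_id pt_const pt_hd pt_tl pt_Pair pt_if pt_dbool pt_dbind pt_dapp pt_dnth pt_dlen
  pt_dupt pp_const pp_Nil pp_not pp_conj pp_disj pp_eq pp_le pp_less pp_len_eq pp_ball
  pp_le_const pp_len_eq_const

lemma dnth_enc_circuit: "i < length C \<Longrightarrow> dnth (enc_circuit C) (enc_nat i) = enc_gate (C ! i)"
  by (simp add: enc_circuit_def)

text \<open>A negation is encoded with a bare numeral rather than a list, hence the extra
  case.\<close>

definition dpreds :: "dat \<Rightarrow> dat" where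
  "dpreds y = (if len (dat_hd y) = 0 then Nil_dat
    else if len (dat_hd y) = 1 then Pair_dat (dat_tl y) Nil_dat else dat_tl y)"

lemma dpreds_enc_gate: "dpreds (enc_gate g) = enc_list (map enc_nat (preds g))"
  by (cases g) (auto simp: dpreds_def)

lemma pt_dpreds [intro!]: "pt f \<Longrightarrow> pt (\<lambda>x. dpreds (f x))"
  unfolding dpreds_def by (intro pt_intros)

text \<open>The recursion is on the meta-level number \<open>d\<close>; for each fixed
  \<open>d\<close> it unfolds into a fixed nesting of loops.\<close>

primrec dsmall_ok :: "nat \<Rightarrow> dat \<Rightarrow> dat \<Rightarrow> bool" where
  "dsmall_ok 0 C g = (dpreds (dnth C g) = Nil_dat)"
| "dsmall_ok (Suc d) C g = (len (dpreds (dnth C g)) \<le> 2 \<and>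
    (\<forall>j \<in> set (dl (dpreds (dnth C g))). dsmall_ok d C j))"

primrec dweft_ok :: "nat \<Rightarrow> dat \<Rightarrow> dat \<Rightarrow> bool" where
  "dweft_ok 0 C g = (dpreds (dnth C g) = Nil_dat)"
| "dweft_ok (Suc d) C g =
    (len (dpreds (dnth C g)) \<le> 2 \<and> (\<forall>j \<in> set (dl (dpreds (dnth C g))). dweft_ok d C j) \<or>
     \<not> len (dpreds (dnth C g)) \<le> 2 \<and> (\<forall>j \<in> set (dl (dpreds (dnth C g))). dsmall_ok d C j))"

lemma enc_list_eq_Nil [simp]: "enc_list xs = Nil_dat \<longleftrightarrow> xs = []"
  by (cases xs) auto

lemma dsmall_ok_enc:
  "wf_circuit C \<Longrightarrow> i < length C \<Longrightarrow> dsmall_ok d (enc_circuit C) (enc_nat i) = small_ok d C i"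
proof (induction d arbitrary: i)
  case (Suc d)
  then have "j < length C" if "j \<in> set (preds (C ! i))" for j
    using wf_circuitD(2)[OF Suc.prems that] by simp
  with Suc show ?case by (auto simp: dnth_enc_circuit dpreds_enc_gate)
qed (simp add: dnth_enc_circuit dpreds_enc_gate)

lemma dweft_ok_enc:
  "wf_circuit C \<Longrightarrow> i < length C \<Longrightarrow> dweft_ok d (enc_circuit C) (enc_nat i) = weft_ok d C i"
proof (induction d arbitrary: i)
  case (Suc d)
  then have "j < length C" if "j \<in> set (preds (C ! i))" for j
    using wf_circuitD(2)[OF Suc.prems that] by simp
  with Suc show ?case by (auto simp: dnth_enc_circuit dpreds_enc_gate dsmall_ok_enc)
qed (simp add: dnth_enc_circuit dpreds_enc_gate)

text \<open>The functions \<open>f\<close> and \<open>g\<close> are generalised because the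
  recursive call stands under a comprehension, where the input is a pair and \<open>f\<close> is
  preceded by a projection.\<close>

lemma pp_dsmall_ok [intro!]: "pt f \<Longrightarrow> pt g \<Longrightarrow> pp (\<lambda>x. dsmall_ok d (f x) (g x))"
proof (induction d arbitrary: f g)
  case 0
  then show ?case unfolding dsmall_ok.simps by (intro pt_intros pt_dpreds)
next
  case (Suc d)
  have 1: "pt (\<lambda>x. f (h x))" if "pt h" for h
    by (rule pt_comp[OF Suc.prems(1) that])
  show ?case unfolding dsmall_ok.simps by (intro Suc pt_intros pt_dpreds 1)
qed

lemma pp_dweft_ok [intro!]: "pt f \<Longrightarrow> pt g \<Longrightarrow> pp (\<lambda>x. dweft_ok d (f x) (g x))"
proof (induction d arbitrary: f g)
  case 0
  then show ?case unfolding dweft_ok.simps by (intro pt_intros pt_dpreds)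
next
  case (Suc d)
  have 1: "pt (\<lambda>x. f (h x))" if "pt h" for h
    by (rule pt_comp[OF Suc.prems(1) that])
  show ?case unfolding dweft_ok.simps by (intro Suc pt_intros pt_dpreds pp_dsmall_ok 1)
qed

section \<open>Normal forms\<close>

abbreviation single :: "dat \<Rightarrow> dat" where "single y \<equiv> Pair_dat y Nil_dat"

definition dneg :: "dat \<Rightarrow> dat" where "dneg b = dbool (b = Nil_dat)"

lemma dneg_eq_Nil [simp]: "dneg b = Nil_dat \<longleftrightarrow> b \<noteq> Nil_dat"
  by (simp add: dneg_def)

lemma pt_dneg [intro!]: "pt f \<Longrightarrow> pt (\<lambda>x. dneg (f x))"
  unfolding dneg_def by (intro pt_intros)

text \<open>Distributivity as pairwise concatenation. It conjoins two lists of conjunctions, and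
  equally two lists of alternatives, because appending lists of prohibitions imposes both.\<close>

definition dprod :: "dat \<Rightarrow> dat \<Rightarrow> dat" where
  "dprod A B = dbind A (\<lambda>t. dbind B (\<lambda>u. single (dapp t u)))"

lemma pt_dprod [intro!]: "pt f \<Longrightarrow> pt g \<Longrightarrow> pt (\<lambda>x. dprod (f x) (g x))"
  unfolding dprod_def by (rule pt_dbind, assumption, rule pt_dbind, rule pt_comp[of g], assumption) (intro pt_intros)+

abbreviation did :: "dat \<Rightarrow> dat" where "did e \<equiv> dat_hd e"
abbreviation dcol :: "dat \<Rightarrow> dat" where "dcol e \<equiv> dat_hd (dat_tl e)"
abbreviation dpos :: "dat \<Rightarrow> dat" where "dpos e \<equiv> dat_tl (dat_tl e)"

text \<open>An element is a triple of its vertex number, its index and its value; the values \<open>0\<close>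
  and \<open>n + 1\<close> of a circuit with \<open>n\<close> gates are the sentinels, so gate \<open>g\<close> has value \<open>g + 1\<close>.\<close>

definition leaf :: "dat \<Rightarrow> dat \<Rightarrow> dat \<Rightarrow> dat" where
  "leaf E b g = (if b = Nil_dat then
     dbind E (\<lambda>e. dbind E (\<lambda>e'.
       if len (dcol e') = len (Pair_dat Nil_dat (dcol e)) \<and> len (dpos e) < len (Pair_dat Nil_dat g) \<and>
         len (Pair_dat Nil_dat g) < len (dpos e')
       then single (Pair_dat e (single e')) else Nil_dat))
   else dbind E (\<lambda>e. if len (dpos e) = len (Pair_dat Nil_dat g) then single (single e) else Nil_dat))"

lemma pt_leaf [intro!]:
  assumes "pt E" "pt b" "pt g" shows "pt (\<lambda>x. leaf (E x) (b x) (g x))"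
proof -
  have 1: "pt (\<lambda>x. E (f x))" "pt (\<lambda>x. b (f x))" "pt (\<lambda>x. g (f x))" if "pt f" for f
    by (rule pt_comp[OF assms(1) that] pt_comp[OF assms(2) that] pt_comp[OF assms(3) that])+
  show ?thesis unfolding leaf_def by (intro assms pt_intros 1)
qed

text \<open>\<open>P e\<close> is to mean that the element \<open>e\<close> is chosen.\<close>

definition dnf :: "(dat \<Rightarrow> bool) \<Rightarrow> dat \<Rightarrow> bool" where
  "dnf P A \<longleftrightarrow> (\<exists>t \<in> set (dl A). \<forall>e \<in> set (dl t). P e)"

definition opts :: "(dat \<Rightarrow> bool) \<Rightarrow> dat \<Rightarrow> bool" where
  "opts P A \<longleftrightarrow> (\<exists>o' \<in> set (dl A). \<not> dnf P o')"

lemma dnf_dprod: "dnf P (dprod A B) \<longleftrightarrow> dnf P A \<and> dnf P B"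
  by (fastforce simp: dnf_def dprod_def)

lemma dnf_dbind: "dnf P (dbind A F) \<longleftrightarrow> (\<exists>y \<in> set (dl A). dnf P (F y))"
  by (auto simp: dnf_def)

lemma opts_dprod: "opts P (dprod A B) \<longleftrightarrow> opts P A \<and> opts P B"
  by (fastforce simp: opts_def dnf_def dprod_def)

lemma opts_dbind: "opts P (dbind A F) \<longleftrightarrow> (\<exists>y \<in> set (dl A). opts P (F y))"
  by (auto simp: opts_def)

lemma opts_single: "opts P (single A) \<longleftrightarrow> \<not> dnf P A"
  by (simp add: opts_def)

text \<open>\<open>small_nf\<close> is a list of conjunctions one of which holds iff gate \<open>g\<close> has value \<open>b\<close>;
  \<open>top_nf\<close> is a list of alternatives, each a list of conjunctions, such that gate \<open>g\<close> has value
  \<open>b\<close> iff for some alternative no conjunction holds.\<close>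

primrec small_nf :: "nat \<Rightarrow> dat \<Rightarrow> dat \<Rightarrow> dat \<Rightarrow> dat \<Rightarrow> dat" where
  "small_nf 0 C E g b = leaf E b g"
| "small_nf (Suc d) C E g b =
    (if len (dat_hd (dnth C g)) = 0 then leaf E b g
     else if len (dat_hd (dnth C g)) = 1 then small_nf d C E (dat_tl (dnth C g)) (dneg b)
     else if (len (dat_hd (dnth C g)) = 2) = (b \<noteq> Nil_dat) then
       dprod (small_nf d C E (dnth (dat_tl (dnth C g)) Nil_dat) b) (small_nf d C E (dnth (dat_tl (dnth C g)) tt) b)
     else dbind (dat_tl (dnth C g)) (\<lambda>j. small_nf d C E j b))"

primrec top_nf :: "nat \<Rightarrow> dat \<Rightarrow> dat \<Rightarrow> dat \<Rightarrow> dat \<Rightarrow> dat" where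
  "top_nf 0 C E g b = single (leaf E (dneg b) g)"
| "top_nf (Suc d) C E g b =
    (if len (dat_hd (dnth C g)) = 0 then single (leaf E (dneg b) g)
     else if len (dat_hd (dnth C g)) = 1 then top_nf d C E (dat_tl (dnth C g)) (dneg b)
     else if (len (dat_hd (dnth C g)) = 2) = (b \<noteq> Nil_dat) then
       (if len (dat_tl (dnth C g)) \<le> 2 then
          dprod (top_nf d C E (dnth (dat_tl (dnth C g)) Nil_dat) b) (top_nf d C E (dnth (dat_tl (dnth C g)) tt) b)
        else single (dbind (dat_tl (dnth C g)) (\<lambda>j. small_nf d C E j (dneg b))))
     else dbind (dat_tl (dnth C g)) (\<lambda>j. top_nf d C E j b))"

lemma pt_small_nf [intro!]:
  "pt C \<Longrightarrow> pt E \<Longrightarrow> pt g \<Longrightarrow> pt b \<Longrightarrow> pt (\<lambda>x. small_nf d (C x) (E x) (g x) (b x))"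
proof (induction d arbitrary: C E g b)
  case 0
  then show ?case by (simp add: pt_leaf)
next
  case (Suc d)
  have 1: "pt (\<lambda>x. C (f x))" "pt (\<lambda>x. E (f x))" "pt (\<lambda>x. b (f x))" if "pt f" for f
    by (rule pt_comp[OF Suc.prems(1) that] pt_comp[OF Suc.prems(2) that] pt_comp[OF Suc.prems(4) that])+
  show ?case unfolding small_nf.simps
    by (intro Suc pt_intros pt_leaf pt_dneg pt_dprod 1)
qed

lemma pt_top_nf [intro!]:
  "pt C \<Longrightarrow> pt E \<Longrightarrow> pt g \<Longrightarrow> pt b \<Longrightarrow> pt (\<lambda>x. top_nf d (C x) (E x) (g x) (b x))"
proof (induction d arbitrary: C E g b)
  case 0
  then show ?case by (simp add: pt_leaf pt_dneg pt_Pair pt_const)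
next
  case (Suc d)
  have 1: "pt (\<lambda>x. C (f x))" "pt (\<lambda>x. E (f x))" "pt (\<lambda>x. b (f x))" if "pt f" for f
    by (rule pt_comp[OF Suc.prems(1) that] pt_comp[OF Suc.prems(2) that] pt_comp[OF Suc.prems(4) that])+
  show ?case unfolding top_nf.simps
    by (intro Suc pt_intros pt_leaf pt_dneg pt_dprod pt_small_nf 1)
qed

text \<open>The normal forms are verified for any choice predicate under which leaves report
  membership in \<open>T\<close>; how a choice of elements yields such a \<open>T\<close> is settled
  separately.\<close>

context
  fixes C :: circuit and T :: "nat set" and P :: "dat \<Rightarrow> bool" and E :: dat
  assumes wf: "wf_circuit C"
    and leaf: "\<And>i b. i \<in> inputs C \<Longrightarrow> dnf P (leaf E b (enc_nat i)) \<longleftrightarrow> (b \<noteq> Nil_dat) = (i \<in> T)"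
begin

lemma leaf':
  assumes "i < length C" "preds (C ! i) = []"
  shows "dnf P (leaf E b (enc_nat i)) \<longleftrightarrow> gate_vals T C ! i = (b \<noteq> Nil_dat)"
  using leaf[of i b] input_iff[OF wf assms(1)] assms(2) gate_vals_rec(1)[OF wf assms(1)]
  by (auto simp: inputs_def)

lemma two_elems:
  assumes "length js \<le> 2" "proper_gate (And_gate js)"
  obtains j0 j1 where "js = [j0, j1]"
proof (cases js rule: remdups_adj.cases)
  case (3 x y xs)
  then show ?thesis using assms that by simp
qed (use assms in simp_all)

text \<open>By De Morgan, a conjunction required true and a disjunction required false both
  constrain all predecessors, and this is what the test comparing the gate code 2 with
  \<open>b\<close> detects. Fan-in at most 2 together with \<open>proper_gate\<close> gives exactly
  two predecessors, so one \<open>dprod\<close> suffices.\<close>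

lemma small_nf_correct:
  "small_ok d C i \<Longrightarrow> i < length C \<Longrightarrow>
    dnf P (small_nf d (enc_circuit C) E (enc_nat i) b) \<longleftrightarrow> gate_vals T C ! i = (b \<noteq> Nil_dat)"
proof (induction d arbitrary: i b)
  case 0
  then show ?case by (simp add: leaf')
next
  case (Suc d)
  note wfi = wf_circuitD[OF wf Suc.prems(2)]
  have IH: "dnf P (small_nf d (enc_circuit C) E (enc_nat j) b) \<longleftrightarrow> gate_vals T C ! j = (b \<noteq> Nil_dat)"
    if "j \<in> set (preds (C ! i))" for j b
    using Suc.IH[of j b] Suc.prems wfi(2)[OF that] that by auto
  note rec = gate_vals_rec[OF wf Suc.prems(2)]
  show ?case
  proof (cases "C ! i")
    case Input_gate
    then show ?thesis using Suc.prems by (simp add: dnth_enc_circuit leaf')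
  next
    case (Not_gate j)
    then show ?thesis using Suc.prems IH[of j "dneg b"] rec(2) by (auto simp: dnth_enc_circuit)
  next
    case (And_gate js)
    then obtain j0 j1 where js: "js = [j0, j1]" using Suc.prems(1) wfi(1) two_elems[of js] by auto
    have "dnth (enc_list (map enc_nat js)) tt = enc_nat j1" "dnth (enc_list (map enc_nat js)) Nil_dat = enc_nat j0"
      by (simp_all add: js tt_def)
    then show ?thesis using Suc.prems And_gate IH[of j0 b] IH[of j1 b] rec(3)[of js] js
      by (auto simp: dnth_enc_circuit dnf_dprod dnf_dbind)
  next
    case (Or_gate js)
    then obtain j0 j1 where js: "js = [j0, j1]" using Suc.prems(1) wfi(1) two_elems[of js] by auto
    have "dnth (enc_list (map enc_nat js)) tt = enc_nat j1" "dnth (enc_list (map enc_nat js)) Nil_dat = enc_nat j0"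
      by (simp_all add: js tt_def)
    then show ?thesis using Suc.prems Or_gate IH[of j0 b] IH[of j1 b] rec(4)[of js] js
      by (auto simp: dnth_enc_circuit dnf_dprod dnf_dbind)
  qed
qed

text \<open>A conjunctive gate of fan-in 2 multiplies two lists of alternatives. A large conjunctive
  gate has only small gates below it, so a single alternative suffices: it forbids every conjunction
  that would give some predecessor the wrong value. A disjunctive gate of any fan-in unites the
  alternatives of its predecessors; this also covers large ones, since \<open>small_ok\<close>
  implies \<open>weft_ok\<close>.\<close>

lemma top_nf_correct:
  "weft_ok d C i \<Longrightarrow> i < length C \<Longrightarrow>
    opts P (top_nf d (enc_circuit C) E (enc_nat i) b) \<longleftrightarrow> gate_vals T C ! i = (b \<noteq> Nil_dat)"
proof (induction d arbitrary: i b)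
  case 0
  then show ?case by (auto simp: leaf' opts_single)
next
  case (Suc d)
  note wfi = wf_circuitD[OF wf Suc.prems(2)]
  have IH: "opts P (top_nf d (enc_circuit C) E (enc_nat j) b) \<longleftrightarrow> gate_vals T C ! j = (b \<noteq> Nil_dat)"
    if "j \<in> set (preds (C ! i))" for j b
    using Suc.IH[of j b] Suc.prems wfi(2)[OF that] that small_ok_imp_weft_ok by (auto split: if_splits)
  have small: "dnf P (small_nf d (enc_circuit C) E (enc_nat j) b) \<longleftrightarrow> gate_vals T C ! j = (b \<noteq> Nil_dat)"
    if "j \<in> set (preds (C ! i))" "\<not> length (preds (C ! i)) \<le> 2" for j b
    using small_nf_correct[of d j b] Suc.prems wfi(2)[OF that(1)] that by auto
  note rec = gate_vals_rec[OF wf Suc.prems(2)]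
  have two: "dnth (enc_list (map enc_nat [j0, j1])) tt = enc_nat j1" "dnth (enc_list (map enc_nat [j0, j1])) Nil_dat = enc_nat j0" for j0 j1
    by (simp_all add: tt_def)
  show ?case
  proof (cases "C ! i")
    case Input_gate
    then show ?thesis using Suc.prems by (auto simp: dnth_enc_circuit leaf' opts_single)
  next
    case (Not_gate j)
    then show ?thesis using Suc.prems IH[of j "dneg b"] rec(2) by (auto simp: dnth_enc_circuit)
  next
    case (And_gate js)
    show ?thesis
    proof (cases "length js \<le> 2 \<and> b \<noteq> Nil_dat")
      case True
      then obtain j0 j1 where js: "js = [j0, j1]" using And_gate wfi(1) two_elems[of js] by auto
      show ?thesis using Suc.prems And_gate IH[of j0 b] IH[of j1 b] rec(3)[of js] two[of j0 j1] True
        by (simp add: dnth_enc_circuit opts_dprod js del: dnth)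
    next
      case False
      then show ?thesis using Suc.prems And_gate IH small rec(3)[of js]
        by (auto simp: dnth_enc_circuit opts_single dnf_dbind opts_dbind)
    qed
  next
    case (Or_gate js)
    show ?thesis
    proof (cases "length js \<le> 2 \<and> b = Nil_dat")
      case True
      then obtain j0 j1 where js: "js = [j0, j1]" using Or_gate wfi(1) two_elems[of js] by auto
      show ?thesis using Suc.prems Or_gate IH[of j0 b] IH[of j1 b] rec(4)[of js] two[of j0 j1] True
        by (simp add: dnth_enc_circuit opts_dprod js del: dnth)
    next
      case False
      then show ?thesis using Suc.prems Or_gate IH small rec(4)[of js]
        by (auto simp: dnth_enc_circuit opts_single dnf_dbind opts_dbind)
    qed
  qed
qed

end

text \<open>Several arguments travel as one pair, so a binary definition is shown to be
  polynomial-time once, on projections.\<close>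

lemma pt_comp2:
  assumes "pt (\<lambda>z. F (dat_hd z) (dat_tl z))" "pt f" "pt g"
  shows "pt (\<lambda>x. F (f x) (g x))"
  using pt_comp[of "\<lambda>z. F (dat_hd z) (dat_tl z)" "\<lambda>x. Pair_dat (f x) (g x)", OF assms(1) pt_Pair[OF assms(2,3)]]
  by (simp only: dat_hd.simps dat_tl.simps)

lemma pp_comp2:
  assumes "pp (\<lambda>z. P (dat_hd z) (dat_tl z))" "pt f" "pt g"
  shows "pp (\<lambda>x. P (f x) (g x))"
  using assms unfolding pp_def by (rule pt_comp2[of "\<lambda>x y. dbool (P x y)"])

lemma pt_comp3:
  assumes "pt (\<lambda>z. F (dat_hd z) (dat_hd (dat_tl z)) (dat_tl (dat_tl z)))" "pt f" "pt g" "pt h"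
  shows "pt (\<lambda>x. F (f x) (g x) (h x))"
  using pt_comp[of "\<lambda>z. F (dat_hd z) (dat_hd (dat_tl z)) (dat_tl (dat_tl z))"
      "\<lambda>x. Pair_dat (f x) (Pair_dat (g x) (h x))", OF assms(1) pt_Pair[OF assms(2) pt_Pair[OF assms(3,4)]]]
  by (simp only: dat_hd.simps dat_tl.simps)


section \<open>Recognising encoded circuits\<close>

text \<open>\<open>WCS\<close> contains exact encodings only, so a tree with a non-canonical numeral
  has to be recognised and sent to a no-instance.\<close>

definition dnat_ok :: "dat \<Rightarrow> bool" where "dnat_ok z \<longleftrightarrow> (\<forall>w \<in> set (dl z). w = Nil_dat)"

lemma dnat_ok_iff: "dnat_ok z \<longleftrightarrow> z = enc_nat (len z)"
proof
  assume "dnat_ok z"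
  then have "dl z = replicate (len z) Nil_dat"
    by (metis dnat_ok_def len_def replicate_length_same)
  then show "z = enc_nat (len z)" by (simp add: dl_inject[symmetric])
next
  assume "z = enc_nat (len z)"
  then have "dl z = replicate (len z) Nil_dat" by (metis dl_enc_nat)
  then show "dnat_ok z" by (simp add: dnat_ok_def)
qed

lemma dnat_ok_enc_nat [simp]: "dnat_ok (enc_nat n)"
  by (simp add: dnat_ok_def)

lemma pp_dnat_ok: "pt f \<Longrightarrow> pp (\<lambda>x. dnat_ok (f x))"
  unfolding dnat_ok_def by (intro pt_intros)

definition ddistinct :: "dat \<Rightarrow> bool" where
  "ddistinct l \<longleftrightarrow> (\<forall>a \<in> set (dl (dupt l)). \<forall>b \<in> set (dl (dupt l)).
     len a = len b \<or> \<not> len (dnth l a) = len (dnth l b))"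

lemma ddistinct_iff: "ddistinct l \<longleftrightarrow> distinct (map len (dl l))"
  unfolding ddistinct_def distinct_conv_nth by (fastforce simp: len_def[of l])

lemma pp_ddistinct: "pt f \<Longrightarrow> pp (\<lambda>x. ddistinct (f x))"
proof -
  have "pp ddistinct" unfolding ddistinct_def[abs_def] by (intro pt_intros)
  then show "pt f \<Longrightarrow> pp (\<lambda>x. ddistinct (f x))" unfolding pp_def by (rule pt_comp)
qed

definition dgate_ok :: "dat \<Rightarrow> dat \<Rightarrow> bool" where
  "dgate_ok i y \<longleftrightarrow> y \<noteq> Nil_dat \<and> dnat_ok (dat_hd y) \<and>
    (len (dat_hd y) = 0 \<and> dat_tl y = Nil_dat \<or>
     len (dat_hd y) = 1 \<and> dnat_ok (dat_tl y) \<and> len (dat_tl y) < len i \<or>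
     (len (dat_hd y) = 2 \<or> len (dat_hd y) = 3) \<and> (\<forall>j \<in> set (dl (dat_tl y)). dnat_ok j \<and> len j < len i) \<and>
       ddistinct (dat_tl y) \<and> \<not> len (dat_tl y) \<le> 1)"

lemma pp_dgate_ok: "pt f \<Longrightarrow> pt g \<Longrightarrow> pp (\<lambda>x. dgate_ok (f x) (g x))"
proof (rule pp_comp2[of dgate_ok])
  show "pp (\<lambda>z. dgate_ok (dat_hd z) (dat_tl z))"
    unfolding dgate_ok_def by (intro pt_intros pp_dnat_ok pp_ddistinct)
qed

lemma enc_nats_eq: "\<forall>j \<in> set (dl l). dnat_ok j \<Longrightarrow> l = enc_list (map enc_nat (map len (dl l)))"
proof -
  assume "\<forall>j \<in> set (dl l). dnat_ok j"
  then have "map enc_nat (map len (dl l)) = dl l"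
    using dnat_ok_iff by (auto intro!: map_idI simp: comp_def)
  then show ?thesis by (metis enc_list_dl)
qed

lemma dgate_ok_iff:
  "dgate_ok i y \<longleftrightarrow> (\<exists>g. y = enc_gate g \<and> proper_gate g \<and> (\<forall>j \<in> set (preds g). j < len i))"
proof
  assume *: "dgate_ok i y"
  then obtain u v where y: "y = Pair_dat u v" by (cases y) (auto simp: dgate_ok_def)
  have u: "u = enc_nat (len u)" using * y by (simp add: dgate_ok_def dnat_ok_iff)
  consider "len u = 0" "v = Nil_dat" | "len u = 1" "dnat_ok v" "len v < len i"
    | "len u = 2 \<or> len u = 3" "\<forall>j \<in> set (dl v). dnat_ok j \<and> len j < len i" "ddistinct v" "\<not> len v \<le> 1"
    using * y by (auto simp: dgate_ok_def)
  then show "\<exists>g. y = enc_gate g \<and> proper_gate g \<and> (\<forall>j \<in> set (preds g). j < len i)"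
  proof cases
    case 1
    then show ?thesis using u y by (intro exI[of _ Input_gate]) simp
  next
    case 2
    then show ?thesis using u y by (intro exI[of _ "Not_gate (len v)"]) (use dnat_ok_iff in simp)
  next
    case 3
    let ?js = "map len (dl v)"
    have v: "v = enc_list (map enc_nat ?js)" by (rule enc_nats_eq) (use 3 in blast)
    have js: "distinct ?js" "2 \<le> length ?js" "\<forall>j \<in> set ?js. j < len i"
      using 3 by (auto simp: ddistinct_iff len_def[of v])
    have "y = enc_gate (And_gate ?js) \<or> y = enc_gate (Or_gate ?js)"
      using 3(1) u y v by (metis enc_gate.simps(3,4))
    then show ?thesis
    proof
      assume "y = enc_gate (And_gate ?js)"
      then show ?thesis using js by (intro exI[of _ "And_gate ?js"]) simp
    next
      assume "y = enc_gate (Or_gate ?js)"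
      then show ?thesis using js by (intro exI[of _ "Or_gate ?js"]) simp
    qed
  qed
next
  assume "\<exists>g. y = enc_gate g \<and> proper_gate g \<and> (\<forall>j \<in> set (preds g). j < len i)"
  then obtain g where g: "y = enc_gate g" "proper_gate g" "\<forall>j \<in> set (preds g). j < len i" by blast
  have enc: "map (len \<circ> enc_nat) js = js" for js by (simp add: comp_def)
  show "dgate_ok i y"
    using g by (cases g) (auto simp: dgate_ok_def ddistinct_iff enc simp del: enc_nat_simps)
qed

definition dcircuit_ok :: "dat \<Rightarrow> bool" where
  "dcircuit_ok x \<longleftrightarrow> x \<noteq> Nil_dat \<and> (\<forall>i \<in> set (dl (dupt x)). dgate_ok i (dnth x i))"

lemma pp_dcircuit_ok: "pt f \<Longrightarrow> pp (\<lambda>x. dcircuit_ok (f x))"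
proof -
  have "pp dcircuit_ok" unfolding dcircuit_ok_def[abs_def] by (intro pt_intros pp_dgate_ok)
  then show "pt f \<Longrightarrow> pp (\<lambda>x. dcircuit_ok (f x))" unfolding pp_def by (rule pt_comp)
qed

lemma dcircuit_ok_iff: "dcircuit_ok x \<longleftrightarrow> (\<exists>C. x = enc_circuit C \<and> wf_circuit C)"
proof
  assume *: "dcircuit_ok x"
  then have "\<forall>i < len x. \<exists>g. dl x ! i = enc_gate g \<and> proper_gate g \<and> (\<forall>j \<in> set (preds g). j < i)"
    by (auto simp: dcircuit_ok_def dgate_ok_iff)
  then obtain G where G: "\<And>i. i < len x \<Longrightarrow> dl x ! i = enc_gate (G i) \<and> proper_gate (G i) \<and> (\<forall>j \<in> set (preds (G i)). j < i)"
    by metis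
  let ?C = "map G [0..<len x]"
  have "dl x = map enc_gate ?C" by (rule nth_equalityI) (use G in \<open>auto simp: len_def\<close>)
  then have "x = enc_circuit ?C" by (metis enc_circuit_def enc_list_dl)
  moreover have "len x \<noteq> 0" using * by (simp add: dcircuit_ok_def len_def)
  then have "wf_circuit ?C" using G by (simp add: wf_circuit_def)
  ultimately show "\<exists>C. x = enc_circuit C \<and> wf_circuit C" by blast
next
  assume "\<exists>C. x = enc_circuit C \<and> wf_circuit C"
  then show "dcircuit_ok x"
    by (auto simp: dcircuit_ok_def dgate_ok_iff wf_circuit_def enc_circuit_def)
qed


section \<open>The forbidden sets\<close>

text \<open>The entries are pairs of index and value. Prefixing \<open>Nil_dat\<close> adds one to
  each, so that the sentinels (0, 0) and (k + 1, n + 1) strictly enclose all real pairs, where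
  \<open>n\<close> is the number of gates.\<close>

definition slots :: "dat \<Rightarrow> dat \<Rightarrow> dat" where
  "slots C k = Pair_dat (Pair_dat Nil_dat Nil_dat)
    (dapp (dbind (dupt k) (\<lambda>i. dbind (dupt C) (\<lambda>g.
        if len (dat_hd (dnth C g)) = 0 then single (Pair_dat (Pair_dat Nil_dat i) (Pair_dat Nil_dat g)) else Nil_dat)))
      (single (Pair_dat (Pair_dat Nil_dat k) (Pair_dat Nil_dat (dlen C)))))"

lemma pt_slots: "pt f \<Longrightarrow> pt g \<Longrightarrow> pt (\<lambda>x. slots (f x) (g x))"
proof (rule pt_comp2[of slots])
  show "pt (\<lambda>z. slots (dat_hd z) (dat_tl z))" unfolding slots_def by (intro pt_intros)
qed

text \<open>The offset \<open>a\<close> places the alternatives behind the slots and so keeps vertex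
  numbers disjoint.\<close>

definition number :: "dat \<Rightarrow> dat \<Rightarrow> dat" where
  "number a l = dbind (dupt l) (\<lambda>i. single (Pair_dat (dapp a i) (dnth l i)))"

lemma pt_number: "pt f \<Longrightarrow> pt g \<Longrightarrow> pt (\<lambda>x. number (f x) (g x))"
proof (rule pt_comp2[of number])
  show "pt (\<lambda>z. number (dat_hd z) (dat_tl z))" unfolding number_def by (intro pt_intros)
qed

lemma set_number: "set (dl (number a l)) = (\<lambda>i. Pair_dat (dapp a (enc_nat i)) (dl l ! i)) ` {..<len l}"
  by (auto simp: number_def)

text \<open>The index of a slot acts as its colour: one element of each colour is to be
  chosen.\<close>

definition colors :: "dat \<Rightarrow> dat \<Rightarrow> dat" where
  "colors C k = number Nil_dat (slots C k)"

lemma pt_colors: "pt f \<Longrightarrow> pt g \<Longrightarrow> pt (\<lambda>x. colors (f x) (g x))"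
  unfolding colors_def by (intro pt_number pt_slots pt_const)

definition choices :: "nat \<Rightarrow> dat \<Rightarrow> dat \<Rightarrow> dat" where
  "choices d C k = top_nf d C (colors C k) (dat_tl (dlen C)) tt"

lemma pt_choices: "pt f \<Longrightarrow> pt g \<Longrightarrow> pt (\<lambda>x. choices d (f x) (g x))"
  unfolding choices_def by (intro pt_top_nf pt_colors pt_intros)

text \<open>The test \<open>len (did e) < len N\<close> always succeeds; it spares the proof that conjunctions only
  mention elements of \<open>E\<close>.\<close>

definition hyperedges :: "dat \<Rightarrow> dat \<Rightarrow> dat \<Rightarrow> dat" where
  "hyperedges N E Q = dapp
    (dbind E (\<lambda>e. dbind E (\<lambda>e'.
      if \<not> len (did e) = len (did e') \<and> len (dcol e) = len (dcol e') \<or>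
         len (dcol e') = len (Pair_dat Nil_dat (dcol e)) \<and> len (dpos e') \<le> len (dpos e)
      then single (Pair_dat (did e) (single (did e'))) else Nil_dat)))
    (dapp
      (dbind Q (\<lambda>e. dbind Q (\<lambda>e'. if \<not> len (did e) = len (did e')
        then single (Pair_dat (did e) (single (did e'))) else Nil_dat)))
      (dbind Q (\<lambda>q. dbind (dat_tl q) (\<lambda>t. single (Pair_dat (did q)
        (dbind t (\<lambda>e. if len (did e) < len N then single (did e) else Nil_dat)))))))"

lemma pt_hyperedges: "pt f \<Longrightarrow> pt g \<Longrightarrow> pt h \<Longrightarrow> pt (\<lambda>x. hyperedges (f x) (g x) (h x))"
proof (rule pt_comp3[of hyperedges])
  show "pt (\<lambda>z. hyperedges (dat_hd z) (dat_hd (dat_tl z)) (dat_tl (dat_tl z)))"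
    unfolding hyperedges_def by (intro pt_intros)
qed

definition avoids :: "nat set \<Rightarrow> dat \<Rightarrow> bool" where
  "avoids S H \<longleftrightarrow> (\<forall>h \<in> set (dl H). \<not> len ` set (dl h) \<subseteq> S)"

text \<open>Forbidden pairs of elements enforce one value per index and increasing values, and
  forbidden pairs of alternatives enforce a single alternative. An alternative joined with one of
  its conjunctions forbids that conjunction only if the alternative is selected.\<close>

lemma avoids_hyperedges:
  "avoids S (hyperedges N E Q) \<longleftrightarrow>
    (\<forall>e \<in> set (dl E). \<forall>e' \<in> set (dl E). len (did e) \<in> S \<longrightarrow> len (did e') \<in> S \<longrightarrow>
      (len (dcol e) = len (dcol e') \<longrightarrow> len (did e) = len (did e')) \<and>
      (len (dcol e') = Suc (len (dcol e)) \<longrightarrow> len (dpos e) < len (dpos e'))) \<and>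
    (\<forall>q \<in> set (dl Q). \<forall>q' \<in> set (dl Q). len (did q) \<in> S \<longrightarrow> len (did q') \<in> S \<longrightarrow> len (did q) = len (did q')) \<and>
    (\<forall>q \<in> set (dl Q). len (did q) \<in> S \<longrightarrow> \<not> dnf (\<lambda>e. len (did e) < len N \<longrightarrow> len (did e) \<in> S) (dat_tl q))"
    (is "_ \<longleftrightarrow> ?a \<and> ?b \<and> ?c")
proof -
  have app: "avoids S (dapp A B) \<longleftrightarrow> avoids S A \<and> avoids S B" for A B
    by (auto simp: avoids_def)
  have bind: "avoids S (dbind A F) \<longleftrightarrow> (\<forall>y \<in> set (dl A). avoids S (F y))" for A F
    by (auto simp: avoids_def)
  have sing: "avoids S (single h) \<longleftrightarrow> \<not> len ` set (dl h) \<subseteq> S" for h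
    by (simp add: avoids_def)
  have nil: "avoids S Nil_dat" by (simp add: avoids_def)
  have if': "avoids S (if b then A else Nil_dat) \<longleftrightarrow> (b \<longrightarrow> avoids S A)" for b A
    by (simp add: nil)
  have ids: "set (dl (dbind y (\<lambda>e. if len (did e) < len N then single (did e) else Nil_dat))) =
      did ` {e \<in> set (dl y). len (did e) < len N}" for y
    by (auto simp: if_distrib[of dl] split: if_splits)
  have "(\<forall>y \<in> set (dl l). \<not> len ` set (dl (Pair_dat (did q) (dbind y (\<lambda>e. if len (did e) < len N then single (did e) else Nil_dat)))) \<subseteq> S)
      \<longleftrightarrow> (len (did q) \<in> S \<longrightarrow> \<not> dnf (\<lambda>e. len (did e) < len N \<longrightarrow> len (did e) \<in> S) l)" for q l
    unfolding dnf_def dl.simps list.set ids by auto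
  then have "?c \<longleftrightarrow> avoids S (dbind Q (\<lambda>q. dbind (dat_tl q) (\<lambda>t. single (Pair_dat (did q)
        (dbind t (\<lambda>e. if len (did e) < len N then single (did e) else Nil_dat))))))"
    unfolding bind sing by blast
  moreover have "?b \<longleftrightarrow> avoids S (dbind Q (\<lambda>e. dbind Q (\<lambda>e'. if \<not> len (did e) = len (did e')
        then single (Pair_dat (did e) (single (did e'))) else Nil_dat)))"
    unfolding bind if' sing by auto
  moreover have "?a \<longleftrightarrow> avoids S (dbind E (\<lambda>e. dbind E (\<lambda>e'.
      if \<not> len (did e) = len (did e') \<and> len (dcol e) = len (dcol e') \<or>
         len (dcol e') = len (Pair_dat Nil_dat (dcol e)) \<and> len (dpos e') \<le> len (dpos e)
      then single (Pair_dat (did e) (single (did e'))) else Nil_dat)))"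
    unfolding bind if' sing by (auto simp: not_less[symmetric])
  ultimately show ?thesis unfolding hyperedges_def app by blast
qed

text \<open>\<open>y\<close> is the enumeration with its sentinels; \<open>P1\<close> puts chosen
  elements on its graph and \<open>P2\<close> represents every index. A strictly increasing sequence
  from 0 to \<open>n + 1\<close> misses a value in between iff two consecutive terms enclose
  it.\<close>

lemma leaf_correct:
  assumes y0: "y 0 = 0" and yk: "y (Suc k) = Suc n" and mono: "\<And>c. c \<le> k \<Longrightarrow> y c < y (Suc c)"
    and P1: "\<And>e. e \<in> set (dl E) \<Longrightarrow> P e \<Longrightarrow> len (dcol e) \<le> Suc k \<and> len (dpos e) = y (len (dcol e))"
    and P2: "\<And>c. c \<le> Suc k \<Longrightarrow> \<exists>e \<in> set (dl E). P e \<and> len (dcol e) = c"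
    and g: "g < n"
  shows "dnf P (leaf E b (enc_nat g)) \<longleftrightarrow> (b \<noteq> Nil_dat) = (\<exists>c \<in> {1..k}. y c = Suc g)"
proof -
  have between: "y c < y c'" if "c < c'" "c' \<le> Suc k" for c c'
    using that
  proof (induction c')
    case (Suc c')
    then show ?case using mono[of c'] by (cases "c = c'") auto
  qed simp
  \<comment> \<open>The sentinel values 0 and \<open>n + 1\<close> never equal \<open>Suc g\<close>,
    so admitting the outer indices changes nothing.\<close>
  have hit: "(\<exists>c \<in> {1..k}. y c = Suc g) \<longleftrightarrow> (\<exists>c \<le> Suc k. y c = Suc g)" (is "?l \<longleftrightarrow> ?r")
  proof
    assume ?r
    then obtain c where c: "c \<le> Suc k" "y c = Suc g" by blast
    have "c \<noteq> 0" using c(2) y0 by (intro notI) simp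
    moreover have "c \<noteq> Suc k" using c(2) yk g by (intro notI) simp
    ultimately have "c \<in> {1..k}" using c(1) by simp
    then show ?l using c(2) by blast
  next
    assume ?l
    then show ?r by (meson atLeastAtMost_iff le_SucI)
  qed
  show ?thesis
  proof (cases "b = Nil_dat")
    case False
    have "dnf P (leaf E b (enc_nat g)) \<longleftrightarrow> (\<exists>e \<in> set (dl E). len (dpos e) = Suc g \<and> P e)"
      unfolding leaf_def dnf_def using False by (auto simp: if_distrib[of dl] split: if_splits)
    also have "\<dots> \<longleftrightarrow> (\<exists>c \<le> Suc k. y c = Suc g)"
      (is "?l \<longleftrightarrow> ?r")
    proof
      assume ?l
      then obtain e where "e \<in> set (dl E)" "len (dpos e) = Suc g" "P e" by blast
      then show ?r using P1[of e] by auto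
    next
      assume ?r
      then obtain c where c: "c \<le> Suc k" "y c = Suc g" by blast
      obtain e where "e \<in> set (dl E)" "P e" "len (dcol e) = c" using P2[OF c(1)] by blast
      then show ?l using P1[of e] c(2) by auto
    qed
    finally show ?thesis using False hit by simp
  next
    case True
    have "dnf P (leaf E b (enc_nat g)) \<longleftrightarrow> (\<exists>e \<in> set (dl E). \<exists>e' \<in> set (dl E). len (dcol e') = Suc (len (dcol e)) \<and>
        len (dpos e) < Suc g \<and> Suc g < len (dpos e') \<and> P e \<and> P e')"
      unfolding leaf_def dnf_def using True by (auto simp: if_distrib[of dl] split: if_splits)
    also have "\<dots> \<longleftrightarrow> (\<exists>c \<le> k. y c < Suc g \<and> Suc g < y (Suc c))" (is "?l \<longleftrightarrow> ?r")
    proof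
      assume ?l
      then obtain e e' where e: "e \<in> set (dl E)" "e' \<in> set (dl E)" "P e" "P e'"
        "len (dcol e') = Suc (len (dcol e))" "len (dpos e) < Suc g" "Suc g < len (dpos e')" by blast
      then show ?r using P1[of e] P1[of e'] by (intro exI[of _ "len (dcol e)"]) simp
    next
      assume ?r
      then obtain c where c: "c \<le> k" "y c < Suc g" "Suc g < y (Suc c)" by blast
      obtain e e' where e: "e \<in> set (dl E)" "P e" "len (dcol e) = c"
        and e': "e' \<in> set (dl E)" "P e'" "len (dcol e') = Suc c"
        using P2[of c] P2[of "Suc c"] c(1) by auto
      then have "len (dpos e) < Suc g" "Suc g < len (dpos e')" using P1[of e] P1[of e'] c by auto
      with e e' show ?l by metis
    qed
    also have "\<dots> \<longleftrightarrow> \<not> (\<exists>c \<le> Suc k. y c = Suc g)" (is "?l \<longleftrightarrow> ?r")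
    proof
      assume ?l
      then obtain c where c: "c \<le> k" "y c < Suc g" "Suc g < y (Suc c)" by blast
      show ?r
      proof
        assume "\<exists>c \<le> Suc k. y c = Suc g"
        then obtain c' where c': "c' \<le> Suc k" "y c' = Suc g" by blast
        then have "c' \<noteq> c" "c' \<noteq> Suc c" using c by auto
        then consider "c' < c" | "Suc c < c'" by linarith
        then show False using between[of c' c] between[of "Suc c" c'] c c' by cases auto
      qed
    next
      assume r: ?r
      obtain l where l: "Suc l < Suc (Suc k)" "(y l < Suc g) \<noteq> (y (Suc l) < Suc g)"
        using adjacent_change[of "\<lambda>c. y c < Suc g" 0 "Suc k" "Suc (Suc k)"] y0 yk g by auto
      have "y l < y (Suc l)" using mono[of l] l(1) by simp
      with l(2) have "y l < Suc g" "\<not> y (Suc l) < Suc g" by auto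
      moreover have "y (Suc l) \<noteq> Suc g" using r l(1) by auto
      ultimately show ?l using l(1) by (intro exI[of _ l]) auto
    qed
    finally show ?thesis using True hit by simp
  qed
qed

lemma slots_set:
  "(\<lambda>w. (len (dat_hd w), len (dat_tl w))) ` set (dl (slots (enc_circuit C) (enc_nat k))) =
    {(0, 0), (Suc k, Suc (length C))} \<union> {(Suc i, Suc g) | i g. i < k \<and> g \<in> inputs C}"
proof -
  have inp: "len (dat_hd (dnth (enc_circuit C) (enc_nat g))) = 0 \<longleftrightarrow> g \<in> inputs C" if "g < length C" for g
    using that by (cases "C ! g") (auto simp: dnth_enc_circuit inputs_def)
  have C: "len (enc_circuit C) = length C" by (simp add: enc_circuit_def)
  let ?mid = "dbind (dupt (enc_nat k)) (\<lambda>i. dbind (dupt (enc_circuit C)) (\<lambda>g.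
        if len (dat_hd (dnth (enc_circuit C) g)) = 0 then single (Pair_dat (Pair_dat Nil_dat i) (Pair_dat Nil_dat g)) else Nil_dat))"
  have "set (dl ?mid) = {Pair_dat (enc_nat (Suc i)) (enc_nat (Suc g)) | i g. i < k \<and> g < length C \<and>
      len (dat_hd (dnth (enc_circuit C) (enc_nat g))) = 0}"
    by (auto simp: C if_distrib[of dl] simp del: dnth split: if_splits) blast
  also have "\<dots> = {Pair_dat (enc_nat (Suc i)) (enc_nat (Suc g)) | i g. i < k \<and> g \<in> inputs C}"
    using inp by (auto simp: inputs_def simp del: dnth)
  finally have "set (dl ?mid) = {Pair_dat (enc_nat (Suc i)) (enc_nat (Suc g)) | i g. i < k \<and> g \<in> inputs C}" .
  note mid_set = this
  have mid: "(\<lambda>w. (len (dat_hd w), len (dat_tl w))) ` set (dl ?mid) = {(Suc i, Suc g) | i g. i < k \<and> g \<in> inputs C}"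
    (is "?f ` _ = ?r")
  proof -
    have "?f ` set (dl ?mid) = {?f (Pair_dat (enc_nat (Suc i)) (enc_nat (Suc g))) | i g. i < k \<and> g \<in> inputs C}"
      unfolding mid_set by blast
    then show ?thesis by (simp only: dat_hd.simps dat_tl.simps len_simps)
  qed
  show ?thesis unfolding slots_def dl.simps dl_dapp list.set set_append image_insert image_Un mid
    by (auto simp: C)
qed

lemma inj_on_card_image_atMost:
  assumes "inj_on f S" "f ` S \<subseteq> {..n}" "card S = Suc n"
  shows "f ` S = {..n}"
  using assms by (intro card_subset_eq) (auto simp: card_image)

text \<open>There are \<open>k + 2\<close> indices including those of the sentinels, and the
  alternatives count as one further colour. At most one choice per colour and \<open>k + 3\<close>
  choices in total mean exactly one of each.\<close>

lemma avoids_iff_satisfiable: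
  fixes k :: nat
  assumes wf: "wf_circuit C" and weft: "weft_ok d C (length C - 1)"
  defines "U \<equiv> slots (enc_circuit C) (enc_nat k)"
    and "O' \<equiv> choices d (enc_circuit C) (enc_nat k)"
  shows "(\<exists>S \<subseteq> {..<len U + len O'}. card S = k + 3 \<and>
      avoids S (hyperedges U (colors (enc_circuit C) (enc_nat k)) (number (dlen U) O'))) \<longleftrightarrow>
    (\<exists>T \<subseteq> inputs C. card T = k \<and> satisfies T C)"
proof -
  define n N M where "n = length C" and "N = len U" and "M = len O'"
  define E where "E = colors (enc_circuit C) (enc_nat k)"
  define cl ps where "cl i = len (dat_hd (dl U ! i))" and "ps i = len (dat_tl (dl U ! i))" for i
  \<comment> \<open>Elements numbered \<open>N\<close> or above count as chosen, matching the test
    in \<open>hyperedges\<close> that drops them from conjunctions.\<close>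
  define P where "P S e \<longleftrightarrow> (len (did e) < N \<longrightarrow> len (did e) \<in> S)" for S :: "nat set" and e
  have n: "n \<noteq> 0" "n - 1 < length C" using wf by (auto simp: wf_circuit_def n_def)
  have dapp0: "dapp Nil_dat x = x" for x by (simp add: dl_inject[symmetric])
  have E: "set (dl E) = (\<lambda>i. Pair_dat (enc_nat i) (dl U ! i)) ` {..<N}"
    unfolding E_def colors_def set_number U_def[symmetric] N_def[symmetric] by (simp add: dapp0)
  have Q: "set (dl (number (dlen U) O')) = (\<lambda>j. Pair_dat (enc_nat (N + j)) (dl O' ! j)) ` {..<M}"
    unfolding set_number M_def[symmetric] N_def by (simp add: dlen_def dapp_enc_nat)
  have U: "(\<lambda>i. (cl i, ps i)) ` {..<N} = {(0, 0), (Suc k, Suc n)} \<union> {(Suc i, Suc g) | i g. i < k \<and> g \<in> inputs C}"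
  proof -
    have "set (dl U) = (\<lambda>i. dl U ! i) ` {..<N}" by (auto simp: N_def len_def set_conv_nth)
    then have "(\<lambda>i. (cl i, ps i)) ` {..<N} = (\<lambda>w. (len (dat_hd w), len (dat_tl w))) ` set (dl U)"
      by (simp add: cl_def ps_def image_image)
    then show ?thesis unfolding U_def slots_set n_def .
  qed
  have indep: "avoids S (hyperedges U E (number (dlen U) O')) \<longleftrightarrow>
    (\<forall>i < N. \<forall>i' < N. i \<in> S \<longrightarrow> i' \<in> S \<longrightarrow> (cl i = cl i' \<longrightarrow> i = i') \<and> (cl i' = Suc (cl i) \<longrightarrow> ps i < ps i')) \<and>
    (\<forall>j < M. \<forall>j' < M. N + j \<in> S \<longrightarrow> N + j' \<in> S \<longrightarrow> j = j') \<and>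
    (\<forall>j < M. N + j \<in> S \<longrightarrow> \<not> dnf (P S) (dl O' ! j))" for S
    unfolding avoids_hyperedges E Q
    by (simp add: cl_def ps_def P_def[abs_def] N_def) (unfold Ball_def lessThan_iff, blast)
  have opts: "opts (P S) O' \<longleftrightarrow> gate_vals {g. \<exists>c \<in> {1..k}. y c = Suc g} C ! (n - 1)"
    if y: "y 0 = 0" "y (Suc k) = Suc n" "\<And>c. c \<le> k \<Longrightarrow> y c < y (Suc c)"
      and ps: "\<And>i. i < N \<Longrightarrow> i \<in> S \<Longrightarrow> ps i = y (cl i)"
      and ex: "\<And>c. c \<le> Suc k \<Longrightarrow> \<exists>i < N. i \<in> S \<and> cl i = c" for y S
  proof -
    have cl: "cl i \<le> Suc k" if "i < N" for i
    proof -
      have "(cl i, ps i) \<in> {(0, 0), (Suc k, Suc n)} \<union> {(Suc i, Suc g) | i g. i < k \<and> g \<in> inputs C}"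
        unfolding U[symmetric] using that by blast
      then show ?thesis by auto
    qed
    have "dnf (P S) (leaf E b (enc_nat g)) \<longleftrightarrow> (b \<noteq> Nil_dat) = (\<exists>c \<in> {1..k}. y c = Suc g)" if "g \<in> inputs C" for g b
    proof (rule leaf_correct[where n = n])
      show "len (dcol e) \<le> Suc k \<and> len (dpos e) = y (len (dcol e))" if e: "e \<in> set (dl E)" "P S e" for e
      proof -
        obtain i where i: "i < N" "e = Pair_dat (enc_nat i) (dl U ! i)" using e(1) unfolding E by blast
        then have "i \<in> S" using e(2) by (simp add: P_def)
        then show ?thesis using cl[OF i(1)] ps[OF i(1)] i(2) by (simp only: cl_def ps_def dat_tl.simps)
      qed
      show "\<exists>e \<in> set (dl E). P S e \<and> len (dcol e) = c" if c: "c \<le> Suc k" for c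
      proof -
        obtain i where "i < N" "i \<in> S" "cl i = c"
          using ex[OF c] by blast
        then show ?thesis unfolding E by (auto simp: P_def cl_def)
      qed
      show "g < n" using \<open>g \<in> inputs C\<close> by (simp add: inputs_def n_def)
    qed (fact y)+
    then have leaf: "dnf (P S) (leaf E b (enc_nat g)) \<longleftrightarrow> (b \<noteq> Nil_dat) = (g \<in> {g. \<exists>c \<in> {1..k}. y c = Suc g})"
      if "g \<in> inputs C" for g b
      using that by simp
    have "dat_tl (dlen (enc_circuit C)) = enc_nat (n - 1)"
      using n(1) by (cases n) (auto simp: dlen_def enc_circuit_def n_def)
    then show ?thesis
      using top_nf_correct[of C "P S" E "{g. \<exists>c \<in> {1..k}. y c = Suc g}", OF wf leaf, of d "n - 1" tt] weft n
      by (simp add: O'_def choices_def E_def n_def)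
  qed
  have opts_iff: "opts p O' \<longleftrightarrow> (\<exists>j < M. \<not> dnf p (dl O' ! j))" for p
    by (auto simp: opts_def M_def len_def set_conv_nth)
  have sat: "satisfies T C \<longleftrightarrow> gate_vals T C ! (n - 1)" for T
    using satisfies_iff[of C T] wf by (simp add: n_def wf_circuit_def)
  show ?thesis
    unfolding E_def[symmetric] N_def[symmetric] M_def[symmetric] indep sat
  proof
    assume "\<exists>S \<subseteq> {..<N + M}. card S = k + 3 \<and>
      ((\<forall>i < N. \<forall>i' < N. i \<in> S \<longrightarrow> i' \<in> S \<longrightarrow> (cl i = cl i' \<longrightarrow> i = i') \<and> (cl i' = Suc (cl i) \<longrightarrow> ps i < ps i')) \<and>
      (\<forall>j < M. \<forall>j' < M. N + j \<in> S \<longrightarrow> N + j' \<in> S \<longrightarrow> j = j') \<and>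
      (\<forall>j < M. N + j \<in> S \<longrightarrow> \<not> dnf (P S) (dl O' ! j)))"
    then obtain S where S: "S \<subseteq> {..<N + M}" "card S = k + 3"
      and S1: "\<And>i i'. i < N \<Longrightarrow> i' < N \<Longrightarrow> i \<in> S \<Longrightarrow> i' \<in> S \<Longrightarrow> cl i = cl i' \<Longrightarrow> i = i'"
      and S2: "\<And>i i'. i < N \<Longrightarrow> i' < N \<Longrightarrow> i \<in> S \<Longrightarrow> i' \<in> S \<Longrightarrow> cl i' = Suc (cl i) \<Longrightarrow> ps i < ps i'"
      and S3: "\<And>j j'. j < M \<Longrightarrow> j' < M \<Longrightarrow> N + j \<in> S \<Longrightarrow> N + j' \<in> S \<Longrightarrow> j = j'"
      and S4: "\<And>j. j < M \<Longrightarrow> N + j \<in> S \<Longrightarrow> \<not> dnf (P S) (dl O' ! j)" by blast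
    have U': "(cl i, ps i) \<in> {(0, 0), (Suc k, Suc n)} \<union> {(Suc i, Suc g) | i g. i < k \<and> g \<in> inputs C}" if "i < N" for i
      unfolding U[symmetric] using that by blast
    \<comment> \<open>All alternatives share the extra colour \<open>k + 2\<close>, so a single
      pigeonhole argument covers elements and alternatives.\<close>
    define col where "col i = (if i < N then cl i else Suc (Suc k))" for i
    have cl: "cl i \<le> Suc k" if "i < N" for i using U'[OF that] by auto
    have "col ` S = {..Suc (Suc k)}"
    proof (rule inj_on_card_image_atMost)
      show "inj_on col S"
      proof (rule inj_onI)
        fix i i' assume i: "i \<in> S" "i' \<in> S" "col i = col i'"
        then have "i < N \<longleftrightarrow> i' < N" using cl[of i] cl[of i'] by (auto simp: col_def split: if_splits)
        then show "i = i'" 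
        proof (cases "i < N")
          case False
          then have "i - N < M" "i' - N < M" "N + (i - N) = i" "N + (i' - N) = i'"
            using S(1) i \<open>i < N \<longleftrightarrow> i' < N\<close> by auto
          then show ?thesis using S3[of "i - N" "i' - N"] i by metis
        qed (use S1 i in \<open>auto simp: col_def\<close>)
      qed
    qed (use S(2) cl in \<open>auto simp: col_def intro: le_SucI\<close>)
    then have ex: "\<exists>i \<in> S. col i = c" if "c \<le> Suc (Suc k)" for c using that by (metis atMost_iff imageE)
    have ex': "\<exists>i < N. i \<in> S \<and> cl i = c" if c: "c \<le> Suc k" for c
    proof -
      obtain i where i: "i \<in> S" "col i = c" using ex[of c] c by auto
      then have "i < N" using c unfolding col_def by (metis Suc_n_not_le_n)
      then show ?thesis using i by (auto simp: col_def)
    qed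
    define sel where "sel c = (SOME i. i < N \<and> i \<in> S \<and> cl i = c)" for c
    have sel: "sel c < N \<and> sel c \<in> S \<and> cl (sel c) = c" if "c \<le> Suc k" for c
      unfolding sel_def by (rule someI_ex) (use ex'[OF that] in blast)
    define y where "y c = ps (sel c)" for c
    have ps: "ps i = y (cl i)" if "i < N" "i \<in> S" for i
      using sel[OF cl[OF that(1)]] S1[of i "sel (cl i)"] that by (simp add: y_def)
    have y0: "y 0 = 0" using U'[of "sel 0"] sel[of 0] by (auto simp: y_def)
    have yk: "y (Suc k) = Suc n" using U'[of "sel (Suc k)"] sel[of "Suc k"] by (auto simp: y_def)
    have mono: "y c < y (Suc c)" if "c \<le> k" for c
      using S2[of "sel c" "sel (Suc c)"] sel[of c] sel[of "Suc c"] that by (simp add: y_def)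
    have mid: "\<exists>g \<in> inputs C. y c = Suc g" if "c \<in> {1..k}" for c
      using U'[of "sel c"] sel[of c] that by (auto simp: y_def)
    let ?T = "{g. \<exists>c \<in> {1..k}. y c = Suc g}"
    have "?T \<subseteq> inputs C" using mid by force
    moreover have "card ?T = k"
    proof -
      have less: "y c < y c'" if "c < c'" "c' \<le> Suc k" for c c'
        using that
      proof (induction c')
        case (Suc c')
        then show ?case using mono[of c'] by (cases "c = c'") auto
      qed simp
      have "inj_on y {1..k}"
      proof (rule inj_onI)
        fix c c' assume "c \<in> {1..k}" "c' \<in> {1..k}" "y c = y c'"
        then show "c = c'" using less[of c c'] less[of c' c] by (cases c c' rule: linorder_cases) auto
      qed
      \<comment> \<open>Values are gates shifted by one, hence the detour through \<open>Suc\<close>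
        to count the inputs.\<close>
      moreover have "Suc ` ?T = y ` {1..k}" using mid by force
      ultimately have "card (Suc ` ?T) = k" by (simp add: card_image)
      then show ?thesis by (simp add: card_image)
    qed
    moreover have "gate_vals ?T C ! (n - 1)"
    proof -
      obtain i where i: "i \<in> S" "col i = Suc (Suc k)" using ex by blast
      then have "\<not> i < N" using cl[of i] by (auto simp: col_def)
      then have "i - N < M" "N + (i - N) = i" using S(1) i(1) by auto
      with S4[of "i - N"] i(1) have "opts (P S) O'" unfolding opts_iff by auto
      then show ?thesis using opts[of y S, OF y0 yk mono ps ex'] by blast
    qed
    ultimately show "\<exists>T \<subseteq> inputs C. card T = k \<and> gate_vals T C ! (n - 1)" by blast
  next
    assume "\<exists>T \<subseteq> inputs C. card T = k \<and> gate_vals T C ! (n - 1)"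
    then obtain T where T: "T \<subseteq> inputs C" "card T = k" "gate_vals T C ! (n - 1)" by blast
    have inp: "inputs C \<subseteq> {..<n}" by (auto simp: inputs_def n_def)
    have fin: "finite T" by (rule finite_subset[OF subset_trans[OF T(1) inp]]) simp
    define ys where "ys = sorted_list_of_set T"
    have ys: "length ys = k" "set ys = T" "sorted_wrt (<) ys" using fin T(2) by (auto simp: ys_def)
    define y where "y c = (if c = 0 then 0 else if c \<le> k then Suc (ys ! (c - 1)) else Suc n)" for c
    have ysT: "ys ! i \<in> T" if "i < k" for i using ys that nth_mem by blast
    have y0: "y 0 = 0" and yk: "y (Suc k) = Suc n" by (auto simp: y_def)
    have mono: "y c < y (Suc c)" if "c \<le> k" for c
    proof (cases "c = k")
      case True
      then show ?thesis using ysT[of "k - 1"] T(1) inp by (auto simp: y_def)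
    next
      case False
      then show ?thesis using that ys sorted_wrt_nth_less[of "(<)" ys "c - 1" c] by (auto simp: y_def)
    qed
    have Tset: "{g. \<exists>c \<in> {1..k}. y c = Suc g} = T"
    proof -
      have "g \<in> T" if "c \<in> {1..k}" "y c = Suc g" for c g using that ysT[of "c - 1"] by (auto simp: y_def)
      moreover have "\<exists>c \<in> {1..k}. y c = Suc g" if g: "g \<in> T" for g
      proof -
        obtain i where "i < k" "ys ! i = g" using ys g by (metis in_set_conv_nth)
        then show ?thesis by (intro bexI[of _ "Suc i"]) (auto simp: y_def)
      qed
      ultimately show ?thesis by blast
    qed
    have "\<exists>i < N. (cl i, ps i) = (c, y c)" if "c \<le> Suc k" for c
    proof -
      have "(c, y c) \<in> {(0, 0), (Suc k, Suc n)} \<union> {(Suc i, Suc g) | i g. i < k \<and> g \<in> inputs C}"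
      proof (cases "c = 0 \<or> c = Suc k")
        case False
        then have "c = Suc (c - 1)" "c - 1 < k" "y c = Suc (ys ! (c - 1))" using that by (auto simp: y_def)
        then show ?thesis using ysT[of "c - 1"] T(1) by auto
      qed (auto simp: y0 yk)
      then show ?thesis unfolding U[symmetric] by auto
    qed
    then obtain idx where idx: "\<And>c. c \<le> Suc k \<Longrightarrow> idx c < N \<and> cl (idx c) = c \<and> ps (idx c) = y c"
      by (metis prod.inject)
    define S0 where "S0 = idx ` {..Suc k}"
    have S0: "i < N \<and> ps i = y (cl i) \<and> cl i \<le> Suc k \<and> i = idx (cl i)" if "i \<in> S0" for i
      using that idx by (auto simp: S0_def)
    have "card S0 = Suc (Suc k)"
    proof -
      have "inj_on idx {..Suc k}" by (rule inj_onI) (metis atMost_iff idx)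
      then show ?thesis by (simp add: S0_def card_image)
    qed
    have "opts (P S0) O'"
    proof -
      have "\<exists>i < N. i \<in> S0 \<and> cl i = c" if "c \<le> Suc k" for c
        using idx[OF that] that by (auto simp: S0_def)
      then show ?thesis using opts[of y S0, OF y0 yk mono] S0 T(3) unfolding Tset by blast
    qed
    then obtain j where j: "j < M" "\<not> dnf (P S0) (dl O' ! j)" unfolding opts_iff by blast
    let ?S = "insert (N + j) S0"
    have less: "i < N" if "i \<in> S0" for i using S0 that by blast
    \<comment> \<open>The selected alternative has a number of at least \<open>N\<close>, so adding
      it does not change which conjunctions hold.\<close>
    have PS: "P ?S = P S0" by (auto simp: P_def fun_eq_iff)
    have NS: "N + j' \<in> ?S \<longleftrightarrow> j' = j" for j' using less by force
    have pairs: "(cl i = cl i' \<longrightarrow> i = i') \<and> (cl i' = Suc (cl i) \<longrightarrow> ps i < ps i')"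
      if "i < N" "i' < N" "i \<in> ?S" "i' \<in> ?S" for i i'
    proof -
      have "i \<in> S0" "i' \<in> S0" using that by auto
      with S0[of i] S0[of i'] mono[of "cl i"] show ?thesis by (metis Suc_le_mono)
    qed
    show "\<exists>S \<subseteq> {..<N + M}. card S = k + 3 \<and>
      ((\<forall>i < N. \<forall>i' < N. i \<in> S \<longrightarrow> i' \<in> S \<longrightarrow> (cl i = cl i' \<longrightarrow> i = i') \<and> (cl i' = Suc (cl i) \<longrightarrow> ps i < ps i')) \<and>
      (\<forall>j < M. \<forall>j' < M. N + j \<in> S \<longrightarrow> N + j' \<in> S \<longrightarrow> j = j') \<and>
      (\<forall>j < M. N + j \<in> S \<longrightarrow> \<not> dnf (P S) (dl O' ! j)))"
    proof (intro exI[of _ ?S] conjI allI impI)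
      show "?S \<subseteq> {..<N + M}" using less j(1) by force
      show "card ?S = k + 3"
        using \<open>card S0 = Suc (Suc k)\<close> less by (subst card_insert_disjoint) (auto simp: S0_def)
      show "i = i'" if "i < N" "i' < N" "i \<in> ?S" "i' \<in> ?S" "cl i = cl i'" for i i'
        using pairs[OF that(1-4)] that(5) by blast
      show "ps i < ps i'" if "i < N" "i' < N" "i \<in> ?S" "i' \<in> ?S" "cl i' = Suc (cl i)" for i i'
        using pairs[OF that(1-4)] that(5) by blast
      show "j1 = j2" if "j1 < M" "j2 < M" "N + j1 \<in> ?S" "N + j2 \<in> ?S" for j1 j2
        using that(3,4) unfolding NS by simp
      show "\<not> dnf (P ?S) (dl O' ! j')" if "j' < M" "N + j' \<in> ?S" for j'
        using that j(2) unfolding NS PS by blast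
    qed
  qed
qed

section \<open>The reduction\<close>

text \<open>Unary arithmetic for \<open>m + q * L + j\<close>, with the product as a
  comprehension.\<close>

definition dnode :: "dat \<Rightarrow> dat \<Rightarrow> dat \<Rightarrow> dat \<Rightarrow> dat" where
  "dnode m L q j = dapp m (dapp (dbind q (\<lambda>_. L)) j)"

lemma len_dnode [simp]: "len (dnode m L q j) = len m + len q * len L + len j"
proof -
  have "len (dbind q (\<lambda>_. L)) = len q * len L"
    by (simp add: len_def length_concat comp_def sum_list_triv)
  then show ?thesis by (simp add: dnode_def)
qed

lemma pt_dnode: 
  assumes "pt a" "pt b" "pt c" "pt e" shows "pt (\<lambda>x. dnode (a x) (b x) (c x) (e x))"
proof -
  have "pt (\<lambda>x. b (dat_tl x))" by (rule pt_comp[OF assms(2)]) (intro pt_intros)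
  then show ?thesis unfolding dnode_def by (intro assms pt_intros)
qed

definition darc :: "dat \<Rightarrow> dat \<Rightarrow> dat" where
  "darc u v = Pair_dat (dlen u) (dlen v)"

lemma pt_darc: "pt f \<Longrightarrow> pt g \<Longrightarrow> pt (\<lambda>x. darc (f x) (g x))"
  unfolding darc_def by (intro pt_intros)

definition darcs :: "dat \<Rightarrow> dat \<Rightarrow> dat \<Rightarrow> dat" where
  "darcs m H L = Pair_dat (darc (dnode m L Nil_dat (dat_tl L)) m)
    (dapp (dbind (dupt (Pair_dat Nil_dat H)) (\<lambda>q. dbind (dupt (dat_tl L)) (\<lambda>j.
        single (darc (dnode m L q j) (dnode m L q (Pair_dat Nil_dat j))))))
    (dapp (dbind (dupt m) (\<lambda>v. Pair_dat (darc (dnode m L Nil_dat (dat_tl L)) v) (single (darc v m))))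
      (dbind (dupt H) (\<lambda>h. Pair_dat (darc (dnode m L (Pair_dat Nil_dat h) (dat_tl L)) m)
        (dbind (dnth H h) (\<lambda>v. single (darc v (dnode m L (Pair_dat Nil_dat h) Nil_dat))))))))"

text \<open>The vertex count is the number that the start of a block after the last one would
  have.\<close>

definition dgadget :: "dat \<Rightarrow> dat \<Rightarrow> dat \<Rightarrow> dat" where
  "dgadget m H L = Pair_dat (dlen (dnode m L (Pair_dat Nil_dat H) Nil_dat)) (darcs m H L)"

lemma pt_dgadget: "pt f \<Longrightarrow> pt g \<Longrightarrow> pt h \<Longrightarrow> pt (\<lambda>x. dgadget (f x) (g x) (h x))"
proof (rule pt_comp3[of dgadget])
  show "pt (\<lambda>z. dgadget (dat_hd z) (dat_hd (dat_tl z)) (dat_tl (dat_tl z)))"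
    unfolding dgadget_def darcs_def by (intro pt_intros pt_darc pt_dnode)
qed

lemma darc_eq: "darc u v = Pair_dat (enc_nat (len u)) (enc_nat (len v))"
  by (simp add: darc_def dlen_def)

lemma set_darcs:
  "set (dl (darcs m H L)) = (\<lambda>(u, v). Pair_dat (enc_nat u) (enc_nat v)) ` gadget_arcs (len m) (map (map len \<circ> dl) (dl H)) (len L)"
    (is "_ = ?f ` _")
proof -
  let ?H = "map (map len \<circ> dl) (dl H)"
  have H: "length ?H = len H" by (simp add: len_def)
  have H_nth: "set (?H ! h) = len ` set (dl (dnth H (enc_nat h)))" if "h < len H" for h
    using that by (simp add: len_def)
  have "set (dl (darcs m H L)) = {?f (len m + (len L - 1), len m)} \<union>
      ((\<Union>q \<in> {..<Suc (len H)}. \<Union>j \<in> {..<len L - 1}. {?f (len m + q * len L + j, len m + q * len L + Suc j)}) \<union>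
      ((\<Union>v \<in> {..<len m}. {?f (len m + (len L - 1), v), ?f (v, len m)}) \<union>
       (\<Union>h \<in> {..<len H}. insert (?f (len m + Suc h * len L + (len L - 1), len m))
          (\<Union>v \<in> set (dl (dnth H (enc_nat h))). {?f (len v, len m + Suc h * len L)}))))"
    unfolding darcs_def dl.simps list.set dl_dapp set_append dl_dbind set_concat set_map image_image
      dl_dupt set_rev set_upt darc_eq atLeast0LessThan len_dnode
    by (simp add: lessThan_Suc_atMost)
  also have "\<dots> = ?f ` gadget_arcs (len m) ?H (len L)"
  proof -
    have "{(v, len m + Suc h * len L) | v h. h < length ?H \<and> v \<in> set (?H ! h)} =
        (\<Union>h \<in> {..<len H}. \<Union>v \<in> set (dl (dnth H (enc_nat h))). {(len v, len m + Suc h * len L)})"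
      unfolding H using H_nth by blast
    note e = this
    have 1: "{f q j | q j. q < a \<and> j < b} = (\<Union>q \<in> {..<a}. \<Union>j \<in> {..<b}. {f q j})" for f :: "nat \<Rightarrow> nat \<Rightarrow> nat \<times> nat" and a b
      by blast
    have 2: "{f v | v. v < a} \<union> {g v | v. v < a} = (\<Union>v \<in> {..<a}. {f v, g v})" for f g :: "nat \<Rightarrow> nat \<times> nat" and a
      by blast
    have 3: "{f h | h. h < a} \<union> (\<Union>h \<in> {..<a}. \<Union>v \<in> X h. {g h v}) = (\<Union>h \<in> {..<a}. insert (f h) (\<Union>v \<in> X h. {g h v}))"
      for f :: "nat \<Rightarrow> nat \<times> nat" and g and X :: "nat \<Rightarrow> dat set" and a
      by blast
    have "gadget_arcs (len m) ?H (len L) = {(len m + (len L - 1), len m)} \<union>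
        ({(len m + q * len L + j, len m + q * len L + Suc j) | q j. q < Suc (len H) \<and> j < len L - 1} \<union>
        (({(len m + (len L - 1), v) | v. v < len m} \<union> {(v, len m) | v. v < len m}) \<union>
        ({(len m + Suc h * len L + (len L - 1), len m) | h. h < len H} \<union>
        (\<Union>h \<in> {..<len H}. \<Union>v \<in> set (dl (dnth H (enc_nat h))). {(len v, len m + Suc h * len L)}))))"
      unfolding gadget_arcs_def e unfolding H Un_assoc ..
    then show ?thesis unfolding 1 2 3 by (simp only: image_Un image_UN image_insert image_empty)
  qed
  finally show ?thesis .
qed

text \<open>A list of arcs is recovered by decoding. Repeated arcs may occur, but
  \<open>list_digraph\<close> takes \<open>set es\<close>, so knowing the set is enough.\<close>

lemma dgadget_eq:
  obtains es where "dgadget m H L = enc_digraph (gadget_size (len m) (map (map len \<circ> dl) (dl H)) (len L)) es"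
    "set es = gadget_arcs (len m) (map (map len \<circ> dl) (dl H)) (len L)"
proof
  let ?f = "\<lambda>(u, v). Pair_dat (enc_nat u) (enc_nat v)" and ?g = "\<lambda>p. (len (dat_hd p), len (dat_tl p))"
  let ?A = "gadget_arcs (len m) (map (map len \<circ> dl) (dl H)) (len L)"
  let ?es = "map ?g (dl (darcs m H L))"
  have fg: "?g (?f p) = p" for p by (cases p) simp
  have "map ?f ?es = dl (darcs m H L)"
    unfolding map_map comp_def by (rule map_idI) (use set_darcs fg in auto)
  then have "enc_list (map ?f ?es) = darcs m H L" by (metis enc_list_dl)
  then show "dgadget m H L = enc_digraph (gadget_size (len m) (map (map len \<circ> dl) (dl H)) (len L)) ?es"
    by (simp add: dgadget_def enc_digraph_def gadget_size_def dlen_def len_def[of H])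
  have "set ?es = ?g ` ?f ` ?A" by (simp only: set_map set_darcs)
  also have "\<dots> = ?A" by (simp only: image_image fg image_ident)
  finally show "set ?es = ?A" .
qed

lemma dgadget_in_VDPSC_iff:
  assumes "\<And>h v. h \<in> set (dl H) \<Longrightarrow> v \<in> set (dl h) \<Longrightarrow> len v < len m" and "k + 2 \<le> len L"
  shows "(dgadget m H L, k) \<in> VDPSC \<longleftrightarrow> (\<exists>S \<subseteq> {..<len m}. card S = k \<and> avoids S H)"
proof -
  let ?H = "map (map len \<circ> dl) (dl H)"
  obtain es where dg: "dgadget m H L = enc_digraph (gadget_size (len m) ?H (len L)) es"
    "set es = gadget_arcs (len m) ?H (len L)" by (rule dgadget_eq)
  interpret gadget "len m" "len L" ?H es
    by unfold_locales (use assms dg(2) in auto)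
  show ?thesis unfolding dg(1) enc_digraph_in_VDPSC_iff[OF assms(2)] avoids_def by simp
qed

text \<open>3 counts the two sentinels and the alternative; 5 is this 3 plus the slack 2 for the
  block length. Inputs that are not admissible circuits go to \<open>Nil_dat\<close>, which encodes
  no digraph.\<close>

definition reduction :: "nat \<Rightarrow> dat \<Rightarrow> dat \<Rightarrow> dat" where
  "reduction d C k = (if dcircuit_ok C \<and> dweft_ok d C (dat_tl (dlen C)) then
      Pair_dat
        (dgadget (dapp (slots C k) (choices d C k))
          (hyperedges (slots C k) (colors C k) (number (dlen (slots C k)) (choices d C k)))
          (dapp (enc_nat 5) k))
        (dapp (enc_nat 3) k)
    else Pair_dat Nil_dat Nil_dat)"

lemma pt_reduction: "pt (\<lambda>z. reduction d (dat_hd z) (dat_tl z))"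
  unfolding reduction_def
  by (intro pt_intros pp_dcircuit_ok pp_dweft_ok pt_dgadget pt_slots pt_choices pt_hyperedges pt_colors pt_number)

text \<open>Forbidden sets must name elements only. For the elements of conjunctions this is exactly
  what the test in \<open>hyperedges\<close> provides.\<close>

lemma hyperedges_bound:
  assumes "h \<in> set (dl (hyperedges U (number Nil_dat U) (number (dlen U) Q)))" "v \<in> set (dl h)"
  shows "len v < len U + len Q"
proof -
  have 1: "len (did e) < len U" if "e \<in> set (dl (number Nil_dat U))" for e
    using that unfolding set_number by auto
  have 2: "len (did e) < len U + len Q" if "e \<in> set (dl (number (dlen U) Q))" for e
    using that unfolding set_number by auto
  from assms(1) consider e e' where "e \<in> set (dl (number Nil_dat U))" "e' \<in> set (dl (number Nil_dat U))" "dl h = [did e, did e']"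
    | e e' where "e \<in> set (dl (number (dlen U) Q))" "e' \<in> set (dl (number (dlen U) Q))" "dl h = [did e, did e']"
    | q t where "q \<in> set (dl (number (dlen U) Q))" "h = Pair_dat (did q)
        (dbind t (\<lambda>e. if len (did e) < len U then single (did e) else Nil_dat))"
    unfolding hyperedges_def dl_dapp set_append Un_iff
    by (auto simp: if_distrib[of dl] split: if_splits)
  then show ?thesis
  proof cases
    case 1
    then show ?thesis using assms(2) \<open>\<And>e. e \<in> set (dl (number Nil_dat U)) \<Longrightarrow> len (did e) < len U\<close> by fastforce
  next
    case 2
    then show ?thesis using assms(2) \<open>\<And>e. e \<in> set (dl (number (dlen U) Q)) \<Longrightarrow> len (did e) < len U + len Q\<close> by fastforce
  next
    case 3
    then show ?thesis
      using assms(2) \<open>\<And>e. e \<in> set (dl (number (dlen U) Q)) \<Longrightarrow> len (did e) < len U + len Q\<close>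
      by (auto simp: if_distrib[of dl] split: if_splits)
  qed
qed

lemma reduction_correct:
  "\<exists>x' k'. reduction d x (enc_nat k) = Pair_dat x' (enc_nat k') \<and> k' \<le> k + 3 \<and>
    ((x, k) \<in> WCS 1 d \<longleftrightarrow> (x', k') \<in> VDPSC)"
proof (cases "dcircuit_ok x \<and> dweft_ok d x (dat_tl (dlen x))")
  case True
  then obtain C where C: "x = enc_circuit C" "wf_circuit C" unfolding dcircuit_ok_iff by blast
  have len: "dat_tl (dlen x) = enc_nat (length C - 1)" "length C - 1 < length C"
    using C by (cases "length C"; auto simp: dlen_def enc_circuit_def wf_circuit_def)+
  have weft: "weft_ok d C (length C - 1)"
    using True dweft_ok_enc[OF C(2) len(2), of d] unfolding len(1) C(1)[symmetric] by simp
  let ?U = "slots x (enc_nat k)" and ?O = "choices d x (enc_nat k)"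
  let ?g = "dgadget (dapp ?U ?O) (hyperedges ?U (colors x (enc_nat k)) (number (dlen ?U) ?O)) (dapp (enc_nat 5) (enc_nat k))"
  have "(x, k) \<in> WCS 1 d \<longleftrightarrow> (\<exists>T \<subseteq> inputs C. card T = k \<and> satisfies T C)"
    using weft C weft_depth_iff[OF C(2), of d] by (auto simp: WCS_def inj_enc_circuit)
  also have "\<dots> \<longleftrightarrow> (\<exists>S \<subseteq> {..<len (dapp ?U ?O)}. card S = k + 3 \<and>
      avoids S (hyperedges ?U (colors x (enc_nat k)) (number (dlen ?U) ?O)))"
    unfolding C(1) len_simps by (rule avoids_iff_satisfiable[OF C(2) weft, symmetric])
  also have "\<dots> \<longleftrightarrow> (?g, k + 3) \<in> VDPSC"
  proof (rule dgadget_in_VDPSC_iff[symmetric])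
    show "len v < len (dapp ?U ?O)" if "h \<in> set (dl (hyperedges ?U (colors x (enc_nat k)) (number (dlen ?U) ?O)))" "v \<in> set (dl h)" for h v
      using hyperedges_bound[OF that[unfolded colors_def]] by simp
  qed simp
  finally have "(x, k) \<in> WCS 1 d \<longleftrightarrow> (?g, k + 3) \<in> VDPSC" .
  moreover have "reduction d x (enc_nat k) = Pair_dat ?g (enc_nat (k + 3))"
    using True unfolding reduction_def dapp_enc_nat by (simp only: simp_thms if_True add.commute)
  ultimately show ?thesis by blast
next
  case False
  have "(x, k) \<notin> WCS 1 d"
  proof
    assume "(x, k) \<in> WCS 1 d"
    then obtain C where C: "x = enc_circuit C" "wf_circuit C" "weft_at_most 1 C" "depth_at_most d C"
      by (auto simp: WCS_def)
    have len: "dat_tl (dlen x) = enc_nat (length C - 1)" "length C - 1 < length C"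
      using C(1,2) by (cases "length C"; auto simp: dlen_def enc_circuit_def wf_circuit_def)+
    have "dweft_ok d x (dat_tl (dlen x))"
    proof -
      have "weft_ok d C (length C - 1)" using weft_depth_iff[OF C(2), of d] C(3,4) by blast
      then have "dweft_ok d (enc_circuit C) (enc_nat (length C - 1))" using dweft_ok_enc[OF C(2) len(2)] by blast
      then show ?thesis unfolding len(1) unfolding C(1) .
    qed
    then show False using False C(1,2) dcircuit_ok_iff by blast
  qed
  moreover have "(Nil_dat, 0) \<notin> VDPSC" by (auto simp: VDPSC_def enc_digraph_def)
  moreover have "reduction d x (enc_nat k) = Pair_dat Nil_dat (enc_nat 0)"
    using False by (auto simp: reduction_def)
  ultimately show ?thesis by (intro exI[of _ Nil_dat] exI[of _ 0]) simp
qed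

text \<open>Membership of \<open>A\<close> in the class fixes a depth bound \<open>d\<close>, so one
  reduction for each \<open>d\<close> is enough.\<close>

theorem theorem4:
  shows "W_hard 1 VDPSC"
  unfolding W_hard_def W_class_def
proof clarify
  fix A d
  assume "A \<le>\<^sub>f\<^sub>p\<^sub>t WCS 1 d"
  then show "A \<le>\<^sub>f\<^sub>p\<^sub>t VDPSC"
  proof (rule fpt_reducible_pt_trans[OF _ pt_reduction])
    show "\<exists>x' k'. reduction d (dat_hd (Pair_dat x (enc_nat k))) (dat_tl (Pair_dat x (enc_nat k))) = Pair_dat x' (enc_nat k') \<and>
        k' \<le> k + 3 \<and> ((x, k) \<in> WCS 1 d \<longleftrightarrow> (x', k') \<in> VDPSC)" for x k
      unfolding dat_hd.simps dat_tl.simps by (rule reduction_correct)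
  qed
qed

end
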